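(* Let $(A,\mu,E,\Delta,\epsilon)$ be a regular weak multiplier bialgebra over a field $k$, and write $A^*=\mathrm{Lin}(A,k)$. The following are equivalent: (1) $\langle(\mathrm{id}\otimes\omega)T_1(a\otimes b)\mid a,b\in A,\ \omega\in A^*\rangle=A$; (2) $\langle(\mathrm{id}\otimes\omega)T_3(a\otimes b)\mid a,b\in A,\ \omega\in A^*\rangle=A$; (3) $\langle(\mathrm{id}\otimes\epsilon)T_1(a\otimes b)\mid a,b\in A\rangle=A$; (4) $\langle(\mathrm{id}\otimes\epsilon)T_3(a\otimes b)\mid a,b\in A\rangle=A$; (5) $\{\sqcap^R(a)\mid a\in A\}=\{\overline\sqcap^R(a)\mid a\in A\}$. Also the following are equivalent to each other: (1') $\langle(\omega\otimes\mathrm{id})T_2(a\otimes b)\mid a,b\in A,\ \omega\in A^*\rangle=A$; (2') $\langle(\omega\otimes\mathrm{id})T_4(a\otimes b)\mid a,b\in A,\ \omega\in A^*\rangle=A$; (3') $\langle(\epsilon\otimes\mathrm{id})T_2(a\otimes b)\mid a,b\in A\rangle=A$; (4') $\langle(\epsilon\otimes\mathrm{id})T_4(a\otimes b)\mid a,b\in A\rangle=A$; (5') $\{\sqcap^L(a)\mid a\in A\}=\{\overline\sqcap^L(a)\mid a\in A\}$.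
   Context: Let $k$ be a field; $\langle X\rangle$ denotes linear span. A non-unital $k$-algebra $A$ is idempotent if its multiplication $\mu$ is surjective and has non-degenerate multiplication if ($ab=0\ \forall a$)$\Rightarrow b=0$ and ($ba=0\ \forall a$)$\Rightarrow b=0$. $\mathbb M(A)$ is its multiplier algebra (pairs $(\lambda,\rho)$ of linear maps $A\to A$ with $a\lambda(b)=\rho(a)b$), a unital algebra containing $A$ as a dense ideal; $A\otimes A\subseteq\mathbb M(A\otimes A)$. Multiplicative $\gamma:A\to\mathbb M(B)$ with idempotent $e\in\mathbb M(B)$, $\langle\gamma(a)b\rangle=eB$, $\langle b\gamma(a)\rangle=Be$ extends uniquely to multiplicative $\overline\gamma:\mathbb M(A)\to\mathbb M(B)$ with $\overline\gamma(1)=e$. A weak multiplier bialgebra: idempotent $A$ with non-degenerate multiplication, idempotent $E\in\mathbb M(A\otimes A)$, multiplicative linear $\Delta:A\to\mathbb M(A\otimes A)$, linear $\epsilon:A\to k$ with: (i) $T_1(a\otimes b):=\Delta(a)(1\otimes b)$, $T_2(a\otimes b):=(a\otimes1)\Delta(b)$ lie in $A\otimes A$; (ii) $(T_2\otimes\mathrm{id})(\mathrm{id}\otimes T_1)=(\mathrm{id}\otimes T_1)(T_2\otimes\mathrm{id})$; (iii) $(\epsilon\otimes\mathrm{id})T_1=\mu=(\mathrm{id}\otimes\epsilon)T_2$; (iv) $\langle\Delta(a)(b\otimes b')\rangle=\langle E(b\otimes b')\rangle$, $\langle(b\otimes b')\Delta(a)\rangle=\langle(b\otimes b')E\rangle$;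 (v) $(E\otimes1)(1\otimes E)=E^{(3)}=(1\otimes E)(E\otimes1)$ with $E^{(3)}:=(\overline{\mathrm{id}\otimes\Delta})(E)=(\overline{\Delta\otimes\mathrm{id}})(E)$; (vi) $(\epsilon\otimes\mathrm{id})((1\otimes a)E(b\otimes c))=(\epsilon\otimes\mathrm{id})(\Delta(a)(b\otimes c))$ and $(\epsilon\otimes\mathrm{id})((a\otimes b)E(1\otimes c))=(\epsilon\otimes\mathrm{id})((a\otimes b)\Delta(c))$. Regular: also $T_3(a\otimes b):=(1\otimes b)\Delta(a)$ and $T_4(a\otimes b):=\Delta(b)(a\otimes1)$ lie in $A\otimes A$. Multipliers for $a\in A$: $\overline\sqcap^L(a)$ with $\overline\sqcap^L(a)b=(\epsilon\otimes\mathrm{id})((a\otimes1)\Delta(b))$, $b\overline\sqcap^L(a)=(\epsilon\otimes\mathrm{id})((a\otimes b)E)$; $\overline\sqcap^R(a)$ with $b\overline\sqcap^R(a)=(\mathrm{id}\otimes\epsilon)(\Delta(b)(1\otimes a))$, $\overline\sqcap^R(a)b=(\mathrm{id}\otimes\epsilon)(E(b\otimes a))$; $\sqcap^L(a)$ with $\sqcap^L(a)b=(\epsilon\otimes\mathrm{id})(E(a\otimes b))$, $b\sqcap^L(a)=(\epsilon\otimes\mathrm{id})(\Delta(b)(a\otimes1))$; $\sqcap^R(a)$ with $b\sqcap^R(a)=(\mathrm{id}\otimes\epsilon)((b\otimes a)E)$, $\sqcap^R(a)b=(\mathrm{id}\otimes\epsilon)((1\otimes a)\Delta(b))$. *)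

theory Defs
  imports Complex_Main "HOL-Library.Function_Algebras"
begin

text \<open>
Conventions.  The field is a type 'k::field; the algebra A is the whole type 'a, a k-vector
space via the scalar multiplication sc (assumption vector_space sc), with multiplication mu.

Tensor products.  HOL has no tensor products of vector spaces, so we use the canonical
faithful model: an element sum_i a_i (x) b_i of A (x) A is represented by the functional
B |-> sum_i B a_i b_i on bilinear forms B (and 0 on non-bilinear B).  Since bilinear forms
separate the points of A (x) A (over a field), this identifies A (x) A with the subspace AA
spanned by the elementary tensors tens a b.  Likewise for A (x) A (x) A (subspace AAA).
Linear maps defined on elementary tensors are extended by evaluating on forms.

Multipliers of A (x) A (resp. A (x) A (x) A) are pairs (L, R) of maps (left action x |-> m x,
right action x |-> x m); only their values on AA (resp. AAA) are meaningful.  The product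
is (L1,R1)(L2,R2) = (L1 o L2, R2 o R1).
\<close>

type_synonym ('k,'a) ten = "('a \<Rightarrow> 'a \<Rightarrow> 'k) \<Rightarrow> 'k"
type_synonym ('k,'a) ten3 = "('a \<Rightarrow> 'a \<Rightarrow> 'a \<Rightarrow> 'k) \<Rightarrow> 'k"
type_synonym ('k,'a) mlt = "(('k,'a) ten \<Rightarrow> ('k,'a) ten) \<times> (('k,'a) ten \<Rightarrow> ('k,'a) ten)"
type_synonym ('k,'a) mlt3 = "(('k,'a) ten3 \<Rightarrow> ('k,'a) ten3) \<times> (('k,'a) ten3 \<Rightarrow> ('k,'a) ten3)"

definition lin :: "('k::field \<Rightarrow> 'a::ab_group_add \<Rightarrow> 'a) \<Rightarrow> ('a \<Rightarrow> 'k) \<Rightarrow> bool" where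
  "lin sc f \<longleftrightarrow> Vector_Spaces.linear sc (*) f"

definition bilin :: "('k::field \<Rightarrow> 'a::ab_group_add \<Rightarrow> 'a) \<Rightarrow> ('a \<Rightarrow> 'a \<Rightarrow> 'k) \<Rightarrow> bool" where
  "bilin sc B \<longleftrightarrow> (\<forall>a. lin sc (B a)) \<and> (\<forall>b. lin sc (\<lambda>a. B a b))"

definition trilin :: "('k::field \<Rightarrow> 'a::ab_group_add \<Rightarrow> 'a) \<Rightarrow> ('a \<Rightarrow> 'a \<Rightarrow> 'a \<Rightarrow> 'k) \<Rightarrow> bool" where
  "trilin sc C \<longleftrightarrow> (\<forall>a b. lin sc (C a b)) \<and> (\<forall>a c. lin sc (\<lambda>b. C a b c))
                    \<and> (\<forall>b c. lin sc (\<lambda>a. C a b c))"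

definition tsc :: "'k::field \<Rightarrow> ('x \<Rightarrow> 'k) \<Rightarrow> ('x \<Rightarrow> 'k)" where
  "tsc c x = (\<lambda>B. c * x B)"

definition tens :: "('k::field \<Rightarrow> 'a::ab_group_add \<Rightarrow> 'a) \<Rightarrow> 'a \<Rightarrow> 'a \<Rightarrow> ('k,'a) ten" where
  "tens sc a b = (\<lambda>B. if bilin sc B then B a b else 0)"

definition tens3 :: "('k::field \<Rightarrow> 'a::ab_group_add \<Rightarrow> 'a) \<Rightarrow> 'a \<Rightarrow> 'a \<Rightarrow> 'a \<Rightarrow> ('k,'a) ten3" where
  "tens3 sc a b c = (\<lambda>C. if trilin sc C then C a b c else 0)"

definition AA :: "('k::field \<Rightarrow> 'a::ab_group_add \<Rightarrow> 'a) \<Rightarrow> ('k,'a) ten set" where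
  "AA sc = module.span tsc {tens sc a b | a b. True}"

definition AAA :: "('k::field \<Rightarrow> 'a::ab_group_add \<Rightarrow> 'a) \<Rightarrow> ('k,'a) ten3 set" where
  "AAA sc = module.span tsc {tens3 sc a b c | a b c. True}"

definition tmult :: "('k::field \<Rightarrow> 'a::ab_group_add \<Rightarrow> 'a) \<Rightarrow> ('a \<Rightarrow> 'a \<Rightarrow> 'a)
    \<Rightarrow> ('k,'a) ten \<Rightarrow> ('k,'a) ten \<Rightarrow> ('k,'a) ten" where
  "tmult sc mu x y = (\<lambda>B. if bilin sc B
      then x (\<lambda>a b. y (\<lambda>c d. B (mu a c) (mu b d))) else 0)"

definition tmult3 :: "('k::field \<Rightarrow> 'a::ab_group_add \<Rightarrow> 'a) \<Rightarrow> ('a \<Rightarrow> 'a \<Rightarrow> 'a)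
    \<Rightarrow> ('k,'a) ten3 \<Rightarrow> ('k,'a) ten3 \<Rightarrow> ('k,'a) ten3" where
  "tmult3 sc mu x y = (\<lambda>C. if trilin sc C
      then x (\<lambda>a b c. y (\<lambda>a' b' c'. C (mu a a') (mu b b') (mu c c'))) else 0)"

definition mprod :: "('x \<Rightarrow> 'x) \<times> ('x \<Rightarrow> 'x) \<Rightarrow> ('x \<Rightarrow> 'x) \<times> ('x \<Rightarrow> 'x) \<Rightarrow> ('x \<Rightarrow> 'x) \<times> ('x \<Rightarrow> 'x)" where
  "mprod M N = (fst M \<circ> fst N, snd N \<circ> snd M)"

definition is_mult :: "('k::field \<Rightarrow> 'a::ab_group_add \<Rightarrow> 'a) \<Rightarrow> ('a \<Rightarrow> 'a \<Rightarrow> 'a) \<Rightarrow> ('k,'a) mlt \<Rightarrow> bool" where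
  "is_mult sc mu M \<longleftrightarrow>
     (\<forall>x\<in>AA sc. fst M x \<in> AA sc \<and> snd M x \<in> AA sc) \<and>
     (\<forall>x\<in>AA sc. \<forall>y\<in>AA sc. fst M (x + y) = fst M x + fst M y \<and> snd M (x + y) = snd M x + snd M y) \<and>
     (\<forall>c. \<forall>x\<in>AA sc. fst M (tsc c x) = tsc c (fst M x) \<and> snd M (tsc c x) = tsc c (snd M x)) \<and>
     (\<forall>x\<in>AA sc. \<forall>y\<in>AA sc. tmult sc mu x (fst M y) = tmult sc mu (snd M x) y)"

definition is_mult3 :: "('k::field \<Rightarrow> 'a::ab_group_add \<Rightarrow> 'a) \<Rightarrow> ('a \<Rightarrow> 'a \<Rightarrow> 'a) \<Rightarrow> ('k,'a) mlt3 \<Rightarrow> bool" where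
  "is_mult3 sc mu M \<longleftrightarrow>
     (\<forall>x\<in>AAA sc. fst M x \<in> AAA sc \<and> snd M x \<in> AAA sc) \<and>
     (\<forall>x\<in>AAA sc. \<forall>y\<in>AAA sc. fst M (x + y) = fst M x + fst M y \<and> snd M (x + y) = snd M x + snd M y) \<and>
     (\<forall>c. \<forall>x\<in>AAA sc. fst M (tsc c x) = tsc c (fst M x) \<and> snd M (tsc c x) = tsc c (snd M x)) \<and>
     (\<forall>x\<in>AAA sc. \<forall>y\<in>AAA sc. tmult3 sc mu x (fst M y) = tmult3 sc mu (snd M x) y)"

definition meq :: "('k::field \<Rightarrow> 'a::ab_group_add \<Rightarrow> 'a) \<Rightarrow> ('k,'a) mlt \<Rightarrow> ('k,'a) mlt \<Rightarrow> bool" where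
  "meq sc M N \<longleftrightarrow> (\<forall>z\<in>AA sc. fst M z = fst N z \<and> snd M z = snd N z)"

definition meq3 :: "('k::field \<Rightarrow> 'a::ab_group_add \<Rightarrow> 'a) \<Rightarrow> ('k,'a) mlt3 \<Rightarrow> ('k,'a) mlt3 \<Rightarrow> bool" where
  "meq3 sc M N \<longleftrightarrow> (\<forall>z\<in>AAA sc. fst M z = fst N z \<and> snd M z = snd N z)"

definition mis :: "('k::field \<Rightarrow> 'a::ab_group_add \<Rightarrow> 'a) \<Rightarrow> ('a \<Rightarrow> 'a \<Rightarrow> 'a) \<Rightarrow> ('k,'a) mlt \<Rightarrow> ('k,'a) ten \<Rightarrow> bool" where
  "mis sc mu M x \<longleftrightarrow> x \<in> AA sc \<and> (\<forall>y\<in>AA sc. fst M y = tmult sc mu x y \<and> snd M y = tmult sc mu y x)"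

definition one_t :: "('k::field \<Rightarrow> 'a::ab_group_add \<Rightarrow> 'a) \<Rightarrow> ('a \<Rightarrow> 'a \<Rightarrow> 'a) \<Rightarrow> 'a \<Rightarrow> ('k,'a) mlt" where
  "one_t sc mu b =
     ((\<lambda>x B. if bilin sc B then x (\<lambda>c d. B c (mu b d)) else 0),
      (\<lambda>x B. if bilin sc B then x (\<lambda>c d. B c (mu d b)) else 0))"

definition t_one :: "('k::field \<Rightarrow> 'a::ab_group_add \<Rightarrow> 'a) \<Rightarrow> ('a \<Rightarrow> 'a \<Rightarrow> 'a) \<Rightarrow> 'a \<Rightarrow> ('k,'a) mlt" where
  "t_one sc mu a =
     ((\<lambda>x B. if bilin sc B then x (\<lambda>c d. B (mu a c) d) else 0),
      (\<lambda>x B. if bilin sc B then x (\<lambda>c d. B (mu c a) d) else 0))"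

definition T1 where
  "T1 sc mu De a b = (THE x. mis sc mu (mprod (De a) (one_t sc mu b)) x)"
definition T2 where
  "T2 sc mu De a b = (THE x. mis sc mu (mprod (t_one sc mu a) (De b)) x)"
definition T3 where
  "T3 sc mu De a b = (THE x. mis sc mu (mprod (one_t sc mu b) (De a)) x)"
definition T4 where
  "T4 sc mu De a b = (THE x. mis sc mu (mprod (De b) (t_one sc mu a)) x)"

text \<open>slice maps: sl1 w t = (w (x) id) t and sl2 w t = (id (x) w) t, characterised by
  f (sl1 w (sum a_i (x) b_i)) = sum w(a_i) f(b_i) for all linear functionals f\<close>
definition sl1 :: "('k::field \<Rightarrow> 'a::ab_group_add \<Rightarrow> 'a) \<Rightarrow> ('a \<Rightarrow> 'k) \<Rightarrow> ('k,'a) ten \<Rightarrow> 'a" where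
  "sl1 sc w t = (THE c. \<forall>f. lin sc f \<longrightarrow> f c = t (\<lambda>x y. w x * f y))"
definition sl2 :: "('k::field \<Rightarrow> 'a::ab_group_add \<Rightarrow> 'a) \<Rightarrow> ('a \<Rightarrow> 'k) \<Rightarrow> ('k,'a) ten \<Rightarrow> 'a" where
  "sl2 sc w t = (THE c. \<forall>f. lin sc f \<longrightarrow> f c = t (\<lambda>x y. f x * w y))"

definition id_ten :: "('k::field \<Rightarrow> 'a::ab_group_add \<Rightarrow> 'a) \<Rightarrow> ('a \<Rightarrow> 'a \<Rightarrow> ('k,'a) ten) \<Rightarrow> ('k,'a) ten3 \<Rightarrow> ('k,'a) ten3" where
  "id_ten sc F s = (\<lambda>C. if trilin sc C then s (\<lambda>a b c. F b c (\<lambda>x y. C a x y)) else 0)"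
definition ten_id :: "('k::field \<Rightarrow> 'a::ab_group_add \<Rightarrow> 'a) \<Rightarrow> ('a \<Rightarrow> 'a \<Rightarrow> ('k,'a) ten) \<Rightarrow> ('k,'a) ten3 \<Rightarrow> ('k,'a) ten3" where
  "ten_id sc F s = (\<lambda>C. if trilin sc C then s (\<lambda>a b c. F a b (\<lambda>x y. C x y c)) else 0)"

definition E_one :: "('k::field \<Rightarrow> 'a::ab_group_add \<Rightarrow> 'a) \<Rightarrow> ('k,'a) mlt \<Rightarrow> ('k,'a) mlt3" where
  "E_one sc E =
     ((\<lambda>s C. if trilin sc C then s (\<lambda>a b c. fst E (tens sc a b) (\<lambda>x y. C x y c)) else 0),
      (\<lambda>s C. if trilin sc C then s (\<lambda>a b c. snd E (tens sc a b) (\<lambda>x y. C x y c)) else 0))"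
definition one_E :: "('k::field \<Rightarrow> 'a::ab_group_add \<Rightarrow> 'a) \<Rightarrow> ('k,'a) mlt \<Rightarrow> ('k,'a) mlt3" where
  "one_E sc E =
     ((\<lambda>s C. if trilin sc C then s (\<lambda>a b c. fst E (tens sc b c) (\<lambda>x y. C a x y)) else 0),
      (\<lambda>s C. if trilin sc C then s (\<lambda>a b c. snd E (tens sc b c) (\<lambda>x y. C a x y)) else 0))"

definition id_De :: "('k::field \<Rightarrow> 'a::ab_group_add \<Rightarrow> 'a) \<Rightarrow> ('a \<Rightarrow> 'a \<Rightarrow> 'a) \<Rightarrow> ('a \<Rightarrow> ('k,'a) mlt)
     \<Rightarrow> ('k,'a) ten \<Rightarrow> ('k,'a) mlt3" where
  "id_De sc mu De x =
     ((\<lambda>s C. if trilin sc C then x (\<lambda>a b. s (\<lambda>c d f. fst (De b) (tens sc d f) (\<lambda>u v. C (mu a c) u v))) else 0),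
      (\<lambda>s C. if trilin sc C then x (\<lambda>a b. s (\<lambda>c d f. snd (De b) (tens sc d f) (\<lambda>u v. C (mu c a) u v))) else 0))"
definition De_id :: "('k::field \<Rightarrow> 'a::ab_group_add \<Rightarrow> 'a) \<Rightarrow> ('a \<Rightarrow> 'a \<Rightarrow> 'a) \<Rightarrow> ('a \<Rightarrow> ('k,'a) mlt)
     \<Rightarrow> ('k,'a) ten \<Rightarrow> ('k,'a) mlt3" where
  "De_id sc mu De x =
     ((\<lambda>s C. if trilin sc C then x (\<lambda>a b. s (\<lambda>c d f. fst (De a) (tens sc c d) (\<lambda>u v. C u v (mu b f)))) else 0),
      (\<lambda>s C. if trilin sc C then x (\<lambda>a b. s (\<lambda>c d f. snd (De a) (tens sc c d) (\<lambda>u v. C u v (mu f b)))) else 0))"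

text \<open>M is the value at the multiplier m of the (unique) multiplicative extension gbar of
  gamma : A (x) A \<rightarrow> M(A (x) A (x) A) with gbar(1) = e.  Such an extension satisfies
  gbar(m) gamma(x) y = gamma(m x) y, y gamma(x) gbar(m) = y gamma(x m) and
  gbar(m) e = gbar(m) = e gbar(m); these properties determine gbar(m) uniquely
  (because the elements gamma(x) y span e(A (x) A (x) A), and similarly on the right).\<close>
definition is_ext :: "('k::field \<Rightarrow> 'a::ab_group_add \<Rightarrow> 'a) \<Rightarrow> ('a \<Rightarrow> 'a \<Rightarrow> 'a)
     \<Rightarrow> (('k,'a) ten \<Rightarrow> ('k,'a) mlt3) \<Rightarrow> ('k,'a) mlt3 \<Rightarrow> ('k,'a) mlt \<Rightarrow> ('k,'a) mlt3 \<Rightarrow> bool" where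
  "is_ext sc mu g e m M \<longleftrightarrow> is_mult3 sc mu M \<and>
     (\<forall>x\<in>AA sc. \<forall>y\<in>AAA sc. fst M (fst (g x) y) = fst (g (fst m x)) y
                         \<and> snd M (snd (g x) y) = snd (g (snd m x)) y) \<and>
     meq3 sc (mprod M e) M \<and> meq3 sc (mprod e M) M"

definition regular_wmba ::
  "('k::field \<Rightarrow> 'a::ab_group_add \<Rightarrow> 'a) \<Rightarrow> ('a \<Rightarrow> 'a \<Rightarrow> 'a) \<Rightarrow> ('k,'a) mlt
     \<Rightarrow> ('a \<Rightarrow> ('k,'a) mlt) \<Rightarrow> ('a \<Rightarrow> 'k) \<Rightarrow> bool" where
  "regular_wmba sc mu E De eps \<longleftrightarrow>
    \<comment> \<open>A is an associative (non-unital) k-algebra\<close>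
    vector_space sc \<and>
    (\<forall>a. Vector_Spaces.linear sc sc (mu a)) \<and> (\<forall>b. Vector_Spaces.linear sc sc (\<lambda>a. mu a b)) \<and>
    (\<forall>a b c. mu (mu a b) c = mu a (mu b c)) \<and>
    \<comment> \<open>idempotent: mu : A (x) A \<rightarrow> A surjective\<close>
    module.span sc {mu a b | a b. True} = UNIV \<and>
    \<comment> \<open>non-degenerate multiplication\<close>
    (\<forall>b. (\<forall>a. mu a b = 0) \<longrightarrow> b = 0) \<and> (\<forall>b. (\<forall>a. mu b a = 0) \<longrightarrow> b = 0) \<and>
    \<comment> \<open>E is an idempotent multiplier of A (x) A\<close>
    is_mult sc mu E \<and> meq sc (mprod E E) E \<and>
    \<comment> \<open>Delta : A \<rightarrow> M(A (x) A) linear and multiplicative\<close>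
    (\<forall>a. is_mult sc mu (De a)) \<and>
    (\<forall>a b. meq sc (De (a + b)) ((\<lambda>y. fst (De a) y + fst (De b) y), (\<lambda>y. snd (De a) y + snd (De b) y))) \<and>
    (\<forall>c a. meq sc (De (sc c a)) ((\<lambda>y. tsc c (fst (De a) y)), (\<lambda>y. tsc c (snd (De a) y)))) \<and>
    (\<forall>a b. meq sc (De (mu a b)) (mprod (De a) (De b))) \<and>
    \<comment> \<open>epsilon linear\<close>
    lin sc eps \<and>
    \<comment> \<open>(i)\<close>
    (\<forall>a b. \<exists>x. mis sc mu (mprod (De a) (one_t sc mu b)) x) \<and>
    (\<forall>a b. \<exists>x. mis sc mu (mprod (t_one sc mu a) (De b)) x) \<and>
    \<comment> \<open>(ii)\<close>
    (\<forall>a b c. ten_id sc (T2 sc mu De) (id_ten sc (T1 sc mu De) (tens3 sc a b c))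
           = id_ten sc (T1 sc mu De) (ten_id sc (T2 sc mu De) (tens3 sc a b c))) \<and>
    \<comment> \<open>(iii)\<close>
    (\<forall>a b. sl1 sc eps (T1 sc mu De a b) = mu a b \<and> sl2 sc eps (T2 sc mu De a b) = mu a b) \<and>
    \<comment> \<open>(iv)\<close>
    module.span tsc {fst (De a) (tens sc b b') | a b b'. True}
      = module.span tsc {fst E (tens sc b b') | b b'. True} \<and>
    module.span tsc {snd (De a) (tens sc b b') | a b b'. True}
      = module.span tsc {snd E (tens sc b b') | b b'. True} \<and>
    \<comment> \<open>(v), with E3 = (id (x) Delta)-bar(E) = (Delta (x) id)-bar(E)\<close>
    (\<exists>E3. is_ext sc mu (id_De sc mu De) (one_E sc E) E E3 \<and>
          is_ext sc mu (De_id sc mu De) (E_one sc E) E E3 \<and>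
          meq3 sc (mprod (E_one sc E) (one_E sc E)) E3 \<and>
          meq3 sc E3 (mprod (one_E sc E) (E_one sc E))) \<and>
    \<comment> \<open>(vi)\<close>
    (\<forall>a b c. sl1 sc eps (fst (one_t sc mu a) (fst E (tens sc b c)))
             = sl1 sc eps (fst (De a) (tens sc b c))) \<and>
    (\<forall>a b c. sl1 sc eps (snd (one_t sc mu c) (snd E (tens sc a b)))
             = sl1 sc eps (snd (De c) (tens sc a b))) \<and>
    \<comment> \<open>regularity\<close>
    (\<forall>a b. \<exists>x. mis sc mu (mprod (one_t sc mu b) (De a)) x) \<and>
    (\<forall>a b. \<exists>x. mis sc mu (mprod (De b) (t_one sc mu a)) x)"

text \<open>The multipliers of A (as pairs (left action b |-> m b, right action b |-> b m)).\<close>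
definition sqL_bar where
  "sqL_bar sc mu E De eps a = ((\<lambda>b. sl1 sc eps (T2 sc mu De a b)), (\<lambda>b. sl1 sc eps (snd E (tens sc a b))))"
definition sqR_bar where
  "sqR_bar sc mu E De eps a = ((\<lambda>b. sl2 sc eps (fst E (tens sc b a))), (\<lambda>b. sl2 sc eps (T1 sc mu De b a)))"
definition sqL where
  "sqL sc mu E De eps a = ((\<lambda>b. sl1 sc eps (fst E (tens sc a b))), (\<lambda>b. sl1 sc eps (T4 sc mu De a b)))"
definition sqR where
  "sqR sc mu E De eps a = ((\<lambda>b. sl2 sc eps (T3 sc mu De b a)), (\<lambda>b. sl2 sc eps (snd E (tens sc b a))))"

end

theory Submission
  imports Defs
begin

text \<open>
Write \<open>T\<^sub>1(b \<otimes> c) = b\<^sub>1 \<otimes> b\<^sub>2c\<close> and \<open>E = 1\<^sub>1 \<otimes> 1\<^sub>2\<close>, and let \<open>P\<close> be the barred \<open>\<Pi>\<^sup>R\<close>.  Axiom (v) and the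
counit give \<open>E(1 \<otimes> bc) = P(b\<^sub>1) \<otimes> b\<^sub>2c\<close>.  Hence \<open>T\<^sub>1(a \<otimes> bc) = \<Delta>(a)E(1 \<otimes> bc)\<close> has its first leg in
\<open>A P(A)\<close>, which shows that (1) implies (3); dually (2) implies (4).  Conditions (1) and (2) are
compared through \<open>(1 \<otimes> b)\<Delta>(a)(1 \<otimes> c)\<close>, using non-degeneracy and linear functionals.  The same
formula shows \<open>P(\<Pi>\<^sup>R(b)c) = \<Pi>\<^sup>R(b P(c))\<close>, both being \<open>1\<^sub>1\<epsilon>(b1\<^sub>2c)\<close>, so (3) and (4) imply (5).
Conversely \<open>T\<^sub>2 = T\<^sub>2E\<close> and the counit always give \<open>A\<Pi>\<^sup>R(A) = A\<close>, and likewise \<open>P(A)A = A\<close>, so (5)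
implies (3).  The primed conditions are the unprimed ones for the coopposite structure.
\<close>

section \<open>Tensors as functionals on bilinear forms\<close>

text \<open>Without a unit, E and Delta(a) are known only through their products with elements, and
  each T_i exhibits Delta(a) multiplied on one side of one leg. Identities are therefore proved
  after multiplying the free legs by auxiliary elements and evaluating on product functionals;
  non-degeneracy then removes the auxiliary elements. Slicing away all legs but one keeps each
  cancellation inside A.

  By duality over a field, a spanning condition says that a functional killing all the given slices
  is zero. The implications among (1) to (4) thus become inclusions between annihilators.

  The axioms are not symmetric: the counit is given for T1 and T2 only, and (vi) for eps (x) id
  only. The counit for T3 and T4 and the counterpart of (vi) for id (x) eps are derived. The data
  and counit identities are then closed under reversing the product and under flipping the legs of
  Delta, so each argument is carried out once and reread in the mirrored structures.\<close>

lemma tsc_vector_space: "vector_space (tsc :: 'k::field \<Rightarrow> ('x \<Rightarrow> 'k) \<Rightarrow> 'x \<Rightarrow> 'k)"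
  by unfold_locales (auto simp: tsc_def fun_eq_iff algebra_simps)

text \<open>\<open>br x f g\<close> stands for \<open>(f \<otimes> g)(x)\<close>.\<close>

definition br :: "('k::field,'a) ten \<Rightarrow> ('a \<Rightarrow> 'k) \<Rightarrow> ('a \<Rightarrow> 'k) \<Rightarrow> 'k" where
  "br x f g = x (\<lambda>p q. f p * g q)"

definition flip :: "('k,'a) ten \<Rightarrow> ('k,'a) ten" where
  "flip x = (\<lambda>B. x (\<lambda>p q. B q p))"

text \<open>Scalars are absorbed into the first legs, so a list of pairs describes any tensor; this
  makes list induction and finiteness arguments available.\<close>

definition sumtens :: "('k::field \<Rightarrow> 'a::ab_group_add \<Rightarrow> 'a) \<Rightarrow> ('a \<times> 'a) list \<Rightarrow> ('k,'a) ten" where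
  "sumtens sc ps = (\<lambda>B. if bilin sc B then sum_list (map (\<lambda>(a, b). B a b) ps) else 0)"

lemma br_flip [simp]: "br (flip x) f g = br x g f"
  by (simp add: br_def flip_def mult.commute)

lemma sl1_flip [simp]: "sl1 sc f (flip x) = sl2 sc f x"
  by (simp add: sl1_def sl2_def flip_def mult.commute)

lemma sl2_flip [simp]: "sl2 sc f (flip x) = sl1 sc f x"
  by (simp add: sl1_def sl2_def flip_def mult.commute)

lemma bilin_swap: "bilin sc (\<lambda>p q. B q p) \<longleftrightarrow> bilin sc B"
  by (auto simp: bilin_def)

locale tensor_square = vector_space scale
  for scale :: "'k::field \<Rightarrow> 'a::ab_group_add \<Rightarrow> 'a"
begin

abbreviation lfun :: "('a \<Rightarrow> 'k) \<Rightarrow> bool" where "lfun \<equiv> lin scale"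
abbreviation bl :: "('a \<Rightarrow> 'a \<Rightarrow> 'k) \<Rightarrow> bool" where "bl \<equiv> bilin scale"
abbreviation tensors :: "('k,'a) ten set" where "tensors \<equiv> AA scale"
abbreviation slL :: "('a \<Rightarrow> 'k) \<Rightarrow> ('k,'a) ten \<Rightarrow> 'a" where "slL \<equiv> sl1 scale"
abbreviation slR :: "('a \<Rightarrow> 'k) \<Rightarrow> ('k,'a) ten \<Rightarrow> 'a" where "slR \<equiv> sl2 scale"

section \<open>Linear functionals and annihilators\<close>

lemma field_vector_space: "vector_space ((*) :: 'k \<Rightarrow> 'k \<Rightarrow> 'k)"
  by unfold_locales (auto simp: algebra_simps)

lemma pair: "vector_space_pair scale ((*) :: 'k \<Rightarrow> 'k \<Rightarrow> 'k)"
  using field_vector_space vector_space_axioms by (simp add: vector_space_pair_def)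

lemma lin_iff: "lfun f \<longleftrightarrow> (\<forall>x y. f (x + y) = f x + f y) \<and> (\<forall>c x. f (scale c x) = c * f x)"
  unfolding lin_def
  using field_vector_space vector_space_axioms by (simp add: Vector_Spaces.linear_iff)

lemma linD: "lfun f \<Longrightarrow> f (x + y) = f x + f y" "lfun f \<Longrightarrow> f (scale c x) = c * f x"
  by (auto simp: lin_iff)

lemma lin_zero: "lfun f \<Longrightarrow> f 0 = 0"
  using linD(2)[of f 0 0] by simp

lemma lin_uminus: "lfun f \<Longrightarrow> f (- x) = - f x"
  using linD(2)[of f "-1" x] by simp

lemma lin_diff: "lfun f \<Longrightarrow> f (x - y) = f x - f y"
  using linD(1)[of f x "- y"] lin_uminus[of f y] by simp

lemma lin_cmult: "lfun f \<Longrightarrow> lfun (\<lambda>x. c * f x)"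
  by (auto simp: lin_iff algebra_simps)

lemma lin_multc: "lfun f \<Longrightarrow> lfun (\<lambda>x. f x * c)"
  by (auto simp: lin_iff algebra_simps)

lemma lin_0: "lfun (\<lambda>x. 0)"
  by (auto simp: lin_iff)

lemma bilin_prod: "lfun f \<Longrightarrow> lfun g \<Longrightarrow> bl (\<lambda>p q. f p * g q)"
  by (auto simp: bilin_def lin_cmult lin_multc)

lemma bilinI: "(\<And>p. lfun (B p)) \<Longrightarrow> (\<And>q. lfun (\<lambda>p. B p q)) \<Longrightarrow> bl B"
  by (auto simp: bilin_def)

lemma bilinD: "bl B \<Longrightarrow> lfun (B p)" "bl B \<Longrightarrow> lfun (\<lambda>p. B p q)"
  by (auto simp: bilin_def)

text \<open>A basis of \<open>span S\<close> stays independent when \<open>x\<close> is added, and a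
  functional may be prescribed freely on an independent set.\<close>

lemma functional_off_span:
  assumes "x \<notin> span S"
  obtains f where "lfun f" "\<And>y. y \<in> S \<Longrightarrow> f y = 0" "f x = 1"
proof -
  obtain B where B: "B \<subseteq> span S" "independent B" "span S \<subseteq> span B"
    using basis_exists[of "span S"] by metis
  have xB: "x \<notin> span B"
    using B(1) assms span_minimal[OF _ subspace_span] by blast
  have ind: "independent (insert x B)"
    using xB B(2) by (rule independent_insertI)
  obtain f where f: "Vector_Spaces.linear scale (*) f" "\<forall>y\<in>insert x B. f y = (if y = x then 1 else 0)"
    using vector_space_pair.linear_independent_extend[OF pair ind, of "\<lambda>y. if y = x then 1 else 0"] by blast
  have 0: "f y = 0" if "y \<in> B" for y
    using f(2) that xB span_base by fastforce
  have "f y = 0" if "y \<in> S" for y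
    using vector_space_pair.linear_eq_0_on_span[OF pair f(1) 0] B(3) span_base[OF that] by blast
  then show thesis
    using that f by (auto simp: lin_def)
qed

text \<open>Turns the spanning conditions of the theorem into statements about annihilators, where
  elements of A enter only through values of functionals.\<close>

lemma span_eq_UNIV_iff:
  "span S = UNIV \<longleftrightarrow> (\<forall>f. lfun f \<longrightarrow> (\<forall>x\<in>S. f x = 0) \<longrightarrow> (\<forall>x. f x = 0))"
proof
  assume S: "span S = UNIV"
  show "\<forall>f. lfun f \<longrightarrow> (\<forall>x\<in>S. f x = 0) \<longrightarrow> (\<forall>x. f x = 0)"
    using vector_space_pair.linear_eq_0_on_span[OF pair, of _ S] S by (auto simp: lin_def)
next
  assume *: "\<forall>f. lfun f \<longrightarrow> (\<forall>x\<in>S. f x = 0) \<longrightarrow> (\<forall>x. f x = 0)"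
  show "span S = UNIV"
    using functional_off_span * by (metis UNIV_eq_I zero_neq_one)
qed

lemma separate: "(\<And>f. lfun f \<Longrightarrow> f x = f y) \<Longrightarrow> x = y"
proof (rule ccontr)
  assume *: "\<And>f. lfun f \<Longrightarrow> f x = f y" and "x \<noteq> y"
  then have "x - y \<notin> span {}" by simp
  then obtain f where f: "lfun f" "f (x - y) = 1" by (rule functional_off_span)
  then show False using *[of f] by (simp add: lin_diff)
qed

section \<open>Elementary tensors, slices and product forms\<close>

lemma tens_add: "tens scale (a + a') b = tens scale a b + tens scale a' b"
    "tens scale a (b + b') = tens scale a b + tens scale a b'"
  by (auto simp: tens_def fun_eq_iff linD bilinD linD(1)[OF bilinD(2)])

lemma tens_scale: "tens scale (scale c a) b = tsc c (tens scale a b)"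
    "tens scale a (scale c b) = tsc c (tens scale a b)"
  by (auto simp: tens_def tsc_def fun_eq_iff linD bilinD linD(2)[OF bilinD(2)])

lemma sumtens_Nil: "sumtens scale [] = 0"
  by (auto simp: sumtens_def)

lemma sumtens_Cons: "sumtens scale ((a, b) # ps) = tens scale a b + sumtens scale ps"
  by (auto simp: sumtens_def tens_def)

lemma tensors_closed [simp]:
  shows tens_in: "tens scale a b \<in> tensors" and zero_in: "0 \<in> tensors"
    and add_in: "x \<in> tensors \<Longrightarrow> y \<in> tensors \<Longrightarrow> x + y \<in> tensors"
    and tsc_in: "x \<in> tensors \<Longrightarrow> tsc c x \<in> tensors"
proof -
  interpret t: vector_space "tsc :: 'k \<Rightarrow> (('a \<Rightarrow> 'a \<Rightarrow> 'k) \<Rightarrow> 'k) \<Rightarrow> _" by (rule tsc_vector_space)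
  show "tens scale a b \<in> tensors" "0 \<in> tensors"
    "x \<in> tensors \<Longrightarrow> y \<in> tensors \<Longrightarrow> x + y \<in> tensors" "x \<in> tensors \<Longrightarrow> tsc c x \<in> tensors"
    by (auto simp: AA_def t.span_add t.span_scale t.span_zero intro!: t.span_base)
qed

lemma sumtens_in [simp]: "sumtens scale ps \<in> tensors"
proof (induction ps)
  case (Cons p ps)
  then show ?case by (cases p) (simp only: sumtens_Cons add_in tens_in)
qed (simp only: sumtens_Nil zero_in)

lemma tensors_obtain:
  assumes "x \<in> tensors"
  obtains ps where "x = sumtens scale ps"
proof -
  interpret t: vector_space "tsc :: 'k \<Rightarrow> (('a \<Rightarrow> 'a \<Rightarrow> 'k) \<Rightarrow> 'k) \<Rightarrow> _" by (rule tsc_vector_space)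
  have "\<exists>ps. x = sumtens scale ps"
    using assms unfolding AA_def
  proof (induction rule: t.span_induct_alt)
    case base
    show ?case using sumtens_Nil by metis
  next
    case (step c x y)
    then obtain a b ps where "x = tens scale a b" "y = sumtens scale ps" by blast
    then have "tsc c x + y = sumtens scale ((scale c a, b) # ps)"
      by (simp add: sumtens_Cons tens_scale)
    then show ?case by blast
  qed
  then show thesis using that by blast
qed

lemma tensors_induct [consumes 1, case_names zero step]:
  assumes "x \<in> tensors" "P 0" "\<And>a b x. x \<in> tensors \<Longrightarrow> P x \<Longrightarrow> P (tens scale a b + x)"
  shows "P x"
proof -
  obtain ps where x: "x = sumtens scale ps" using assms(1) by (rule tensors_obtain)
  have "P (sumtens scale ps)"
  proof (induction ps)
    case Nil
    show ?case unfolding sumtens_Nil by (rule assms(2))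
  next
    case (Cons p ps)
    obtain a b where p: "p = (a, b)" by (cases p)
    show ?case unfolding p sumtens_Cons by (rule assms(3)[OF sumtens_in Cons.IH])
  qed
  then show ?thesis by (simp only: x)
qed

lemma tensors_not_bilin: "x \<in> tensors \<Longrightarrow> \<not> bl B \<Longrightarrow> x B = 0"
  by (induction rule: tensors_induct) (auto simp: tens_def)

lemma tensors_zero_form [simp]: "x \<in> tensors \<Longrightarrow> x (\<lambda>p q. 0) = 0"
  by (induction rule: tensors_induct) (auto simp: tens_def)

lemma tens_apply: "bl B \<Longrightarrow> tens scale a b B = B a b"
  by (simp add: tens_def)

lemma lin_tensors:
  assumes "x \<in> tensors" "\<And>t. bl (F t)" "\<And>p q. lfun (\<lambda>t. F t p q)"
  shows "lfun (\<lambda>t. x (F t))"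
  using assms(1)
proof (induction rule: tensors_induct)
  case zero
  show ?case by (simp add: lin_0)
next
  case (step a b x)
  then show ?case using assms(2,3)
    by (simp add: tens_apply lin_iff algebra_simps)
qed

text \<open>The element \<open>d\<close> is the image of \<open>x\<close> under the linear map A (x)
  A -> A induced by \<open>m\<close>. A tensor evaluates only to scalars, so an A-valued image has
  to be characterised through functionals.\<close>

lemma tensors_lin_form:
  assumes "x \<in> tensors" "\<And>\<phi>. lfun \<phi> \<Longrightarrow> bl (\<lambda>p q. \<phi> (m p q))"
  shows "\<exists>d. \<forall>\<phi>. lfun \<phi> \<longrightarrow> \<phi> d = x (\<lambda>p q. \<phi> (m p q))"
  using assms(1)
proof (induction rule: tensors_induct)
  case zero
  show ?case by (auto intro: lin_zero)
next
  case (step a b x)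
  then obtain d where d: "\<forall>\<phi>. lfun \<phi> \<longrightarrow> \<phi> d = x (\<lambda>p q. \<phi> (m p q))" by blast
  have "\<forall>\<phi>. lfun \<phi> \<longrightarrow> \<phi> (m a b + d) = (tens scale a b + x) (\<lambda>p q. \<phi> (m p q))"
    using d assms(2) by (simp add: tens_apply linD)
  then show ?case by blast
qed

text \<open>The descriptions in \<open>sl1\<close> and \<open>sl2\<close> denote: existence comes
  from \<open>tensors_lin_form\<close> for p (x) q -> g(q)p or f(p)q, uniqueness from the fact that
  functionals separate points.\<close>

lemma slice:
  assumes "x \<in> tensors" "lfun f" "lfun g"
  shows slR_apply: "f (slR g x) = br x f g" and slL_apply: "g (slL f x) = br x f g"
proof -
  have "\<exists>d. \<forall>\<phi>. lfun \<phi> \<longrightarrow> \<phi> d = x (\<lambda>p q. \<phi> p * g q)"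
    using tensors_lin_form[OF assms(1), of "\<lambda>p q. scale (g q) p"] assms(3)
    by (auto simp: linD mult.commute bilin_prod)
  then have "\<forall>\<phi>. lfun \<phi> \<longrightarrow> \<phi> (slR g x) = x (\<lambda>p q. \<phi> p * g q)"
    unfolding sl2_def by (intro theI'[where P = "\<lambda>d. \<forall>\<phi>. lfun \<phi> \<longrightarrow> \<phi> d = x (\<lambda>p q. \<phi> p * g q)"])
      (metis separate)
  then show "f (slR g x) = br x f g" using assms by (simp add: br_def)
  have "\<exists>d. \<forall>\<phi>. lfun \<phi> \<longrightarrow> \<phi> d = x (\<lambda>p q. f p * \<phi> q)"
    using tensors_lin_form[OF assms(1), of "\<lambda>p q. scale (f p) q"] assms(2)
    by (auto simp: linD bilin_prod)
  then have "\<forall>\<phi>. lfun \<phi> \<longrightarrow> \<phi> (slL f x) = x (\<lambda>p q. f p * \<phi> q)"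
    unfolding sl1_def by (intro theI'[where P = "\<lambda>d. \<forall>\<phi>. lfun \<phi> \<longrightarrow> \<phi> d = x (\<lambda>p q. f p * \<phi> q)"])
      (metis separate)
  then show "g (slL f x) = br x f g" using assms by (simp add: br_def)
qed

text \<open>A bilinear form agrees on the finitely many legs of \<open>x\<close> with a finite sum of product forms,
  the second factors being coordinate functionals of a basis.\<close>

lemma prod_forms_suffice_0:
  assumes x: "x \<in> tensors" and 0: "\<And>f g. lfun f \<Longrightarrow> lfun g \<Longrightarrow> br x f g = 0" and B: "bl B"
  shows "x B = 0"
proof -
  obtain ps where ps: "x = sumtens scale ps" using x by (rule tensors_obtain)
  obtain Bs where Bs: "independent Bs" "span Bs = UNIV"
    using basis_exists[of UNIV] by (metis top.extremum_uniqueI)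
  define g where "g v b = representation Bs b v" for v b
  have g: "lfun (g v)" for v
    unfolding g_def using Bs by (simp add: lin_iff representation_add representation_scale)
  \<comment> \<open>Only finitely many basis vectors occur in the second legs, so one finite index
    set serves all summands.\<close>
  define S where "S = (\<Union>(a, b)\<in>set ps. {v. g v b \<noteq> 0})"
  have finS: "finite S"
    unfolding S_def g_def by (auto simp: finite_representation)
  have b: "B a b = (\<Sum>v\<in>S. B a v * g v b)" if "(a, b) \<in> set ps" for a b
  proof -
    interpret lB: module_hom scale "(*)" "B a"
      using bilinD(1)[OF B, of a] by (simp add: lin_def linear_iff_module_hom)
    have "b = (\<Sum>v | g v b \<noteq> 0. scale (g v b) v)"
      unfolding g_def using sum_nonzero_representation_eq[OF Bs(1)] Bs(2) by simp
    also have "\<dots> = (\<Sum>v\<in>S. scale (g v b) v)"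
      by (rule sum.mono_neutral_left[OF finS]) (use that in \<open>auto simp: S_def\<close>)
    finally have "B a b = B a (\<Sum>v\<in>S. scale (g v b) v)" by simp
    also have "\<dots> = (\<Sum>v\<in>S. B a v * g v b)"
      by (simp add: lB.sum lB.scale mult.commute)
    finally show ?thesis .
  qed
  have "x B = (\<Sum>(a, b)\<leftarrow>ps. \<Sum>v\<in>S. B a v * g v b)"
    unfolding ps sumtens_def using B b by (auto intro!: arg_cong[where f = sum_list] map_cong)
  also have "\<dots> = (\<Sum>v\<in>S. \<Sum>(a, b)\<leftarrow>ps. B a v * g v b)"
    by (induction ps) (auto simp: sum.distrib)
  also have "\<dots> = (\<Sum>v\<in>S. br x (\<lambda>a. B a v) (g v))"
    unfolding br_def ps sumtens_def using bilin_prod[OF bilinD(2)[OF B] g] by simp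
  also have "\<dots> = 0" using 0[OF bilinD(2)[OF B] g] by simp
  finally show ?thesis .
qed

lemma uminus_eq_tsc: "- x = tsc (- 1) x" for x :: "'x \<Rightarrow> 'k"
  by (auto simp: tsc_def)

lemma diff_in [simp]: "x \<in> tensors \<Longrightarrow> y \<in> tensors \<Longrightarrow> x - y \<in> tensors"
  using add_in[of x "tsc (-1) y"] tsc_in[of y "-1"] by (simp only: uminus_eq_tsc[symmetric] add_uminus_conv_diff)

text \<open>Reduces equality of tensors to brackets \<open>br\<close>, in which each leg can be
  treated as an element of A on its own.\<close>

lemma prod_forms_suffice:
  assumes "x \<in> tensors" "y \<in> tensors" "\<And>f g. lfun f \<Longrightarrow> lfun g \<Longrightarrow> br x f g = br y f g"
  shows "x = y"
proof
  fix B
  show "x B = y B"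
  proof (cases "bl B")
    case True
    have "br (x - y) f g = br x f g - br y f g" for f g by (simp add: br_def)
    then have "(x - y) B = 0"
      by (intro prod_forms_suffice_0[OF diff_in[OF assms(1,2)] _ True]) (simp only: assms(3) diff_self)
    then show ?thesis by simp
  qed (simp add: assms tensors_not_bilin)
qed

definition map_tens :: "('a \<Rightarrow> 'a) \<Rightarrow> ('a \<Rightarrow> 'a) \<Rightarrow> ('k,'a) ten \<Rightarrow> ('k,'a) ten" where
  "map_tens h k x = (\<lambda>B. if bl B then x (\<lambda>p q. B (h p) (k q)) else 0)"

lemma map_tens_in [simp]:
  assumes h: "\<And>f. lfun f \<Longrightarrow> lfun (\<lambda>p. f (h p))" and k: "\<And>f. lfun f \<Longrightarrow> lfun (\<lambda>p. f (k p))"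
    and x: "x \<in> tensors"
  shows "map_tens h k x \<in> tensors"
  using x
proof (induction rule: tensors_induct)
  case zero
  have "map_tens h k 0 = 0" by (auto simp: map_tens_def)
  then show ?case by (simp only: zero_in)
next
  case (step a b x)
  have "bl (\<lambda>p q. B (h p) (k q))" if "bl B" for B
    using that h k by (auto simp: bilin_def)
  then have "map_tens h k (tens scale a b + x) = tens scale (h a) (k b) + map_tens h k x"
    by (auto simp: map_tens_def tens_def)
  then show ?case using step by (simp only: add_in tens_in)
qed

lemma br_map_tens: "lfun f \<Longrightarrow> lfun g \<Longrightarrow> br (map_tens h k x) f g = br x (\<lambda>p. f (h p)) (\<lambda>q. g (k q))"
  by (simp add: br_def map_tens_def bilin_prod)

lemma flip_in [simp]: assumes "x \<in> tensors" shows "flip x \<in> tensors"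
  using assms
proof (induction rule: tensors_induct)
  case zero
  have "flip 0 = (0 :: ('k,'a) ten)" by (auto simp: flip_def)
  then show ?case by (simp only: zero_in)
next
  case (step a b x)
  have "flip (tens scale a b + x) B = (tens scale b a + flip x) B" for B
    using bilin_swap[of scale B] by (simp add: flip_def tens_def)
  then have "flip (tens scale a b + x) = tens scale b a + flip x" by (rule ext)
  then show ?case using step by (simp only: add_in tens_in)
qed

section \<open>Linear endomorphisms of A (x) A\<close>

definition endo :: "(('k,'a) ten \<Rightarrow> ('k,'a) ten) \<Rightarrow> bool" where
  "endo e \<longleftrightarrow> (\<forall>x\<in>tensors. e x \<in> tensors) \<and> (\<forall>x\<in>tensors. \<forall>y\<in>tensors. e (x + y) = e x + e y) \<and>
    (\<forall>c. \<forall>x\<in>tensors. e (tsc c x) = tsc c (e x))"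

lemma endo_in [simp]: "endo e \<Longrightarrow> x \<in> tensors \<Longrightarrow> e x \<in> tensors"
  by (simp add: endo_def)

lemma endo_zero: "endo e \<Longrightarrow> e 0 = 0"
proof -
  have *: "tsc 0 x = 0" for x :: "('k,'a) ten" by (auto simp: tsc_def)
  show "e 0 = 0" if "endo e"
    using that zero_in *[of 0] *[of "e 0"] unfolding endo_def by metis
qed

text \<open>Moves an endomorphism from the tensor into the form. \<open>E_one\<close>,
  \<open>one_E\<close>, \<open>id_De\<close> and \<open>De_id\<close> are defined in this shape, so
  they are linked to \<open>E\<close> and \<open>De\<close> through it.\<close>

lemma endo_apply:
  assumes e: "endo e" and "z \<in> tensors" and B: "bl B"
  shows "e z B = z (\<lambda>s t. e (tens scale s t) B)"
  using assms(2)
proof (induction rule: tensors_induct)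
  case zero
  show ?case unfolding endo_zero[OF e] by simp
next
  case (step a b x)
  have "bl (\<lambda>s t. e (tens scale s t) B)"
    using e by (auto simp: bilin_def lin_iff endo_def tens_add tens_scale tsc_def)
  moreover have "e (tens scale a b + x) = e (tens scale a b) + e x"
    using e step(1) by (simp only: endo_def tens_in)
  moreover have "(e (tens scale a b) + e x) B = e (tens scale a b) B + e x B" by (rule plus_fun_apply)
  moreover have "(tens scale a b + x) F = tens scale a b F + x F" for F by (rule plus_fun_apply)
  ultimately have "e (tens scale a b + x) B = (tens scale a b + x) (\<lambda>s t. e (tens scale s t) B)"
    using step.IH by (metis tens_apply)
  then show ?case .
qed

lemma lin_endo_tens:
  assumes "endo e"
  shows "lfun (\<lambda>a. e (tens scale a b) B)" and "lfun (\<lambda>b. e (tens scale a b) B)"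
  using assms by (auto simp: lin_iff endo_def tens_add tens_scale tsc_def)

text \<open>An idempotent fixes its image. With axiom (iv) this will give E Delta(a) = Delta(a) and
  Delta(a) E = Delta(a).\<close>

lemma endo_fixes_span:
  assumes e: "endo e" and idem: "\<And>x. x \<in> tensors \<Longrightarrow> e (e x) = e x"
    and z: "z \<in> module.span tsc {e (tens scale a b) | a b. True}"
  shows "e z = z"
proof -
  interpret t: vector_space "tsc :: 'k \<Rightarrow> (('a \<Rightarrow> 'a \<Rightarrow> 'k) \<Rightarrow> 'k) \<Rightarrow> _" by (rule tsc_vector_space)
  have "z \<in> tensors \<and> e z = z"
    using z
  proof (induction rule: t.span_induct_alt)
    case base
    show ?case by (simp only: endo_zero[OF e] zero_in)
  next
    case (step c x y)
    then obtain a b where x: "x = e (tens scale a b)" by blast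
    have "x \<in> tensors" "e x = x" using e idem by (simp_all add: x)
    moreover have "e (tsc c x + y) = tsc c (e x) + e y"
      using e \<open>x \<in> tensors\<close> step by (simp only: endo_def tsc_in)
    ultimately show ?case using step by (simp only: add_in tsc_in)
  qed
  then show ?thesis ..
qed

lemma tensors_multc: "x \<in> tensors \<Longrightarrow> bl B \<Longrightarrow> x (\<lambda>p q. B p q * c) = x B * c"
proof (induction rule: tensors_induct)
  case (step a b x)
  moreover from \<open>bl B\<close> have "bl (\<lambda>p q. B p q * c)"
    by (simp add: bilin_def lin_multc)
  ultimately show ?case by (simp add: tens_apply algebra_simps)
qed simp

section \<open>Threefold tensors and axiom (v)\<close>

abbreviation tlf :: "('a \<Rightarrow> 'a \<Rightarrow> 'a \<Rightarrow> 'k) \<Rightarrow> bool" where "tlf \<equiv> trilin scale"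

lemma trilinI:
  "(\<And>a b. lfun (C a b)) \<Longrightarrow> (\<And>a c. lfun (\<lambda>b. C a b c)) \<Longrightarrow> (\<And>b c. lfun (\<lambda>a. C a b c)) \<Longrightarrow> tlf C"
  by (simp add: trilin_def)

lemma trilinD:
  assumes "tlf C"
  shows "lfun (C a b)" "lfun (\<lambda>b. C a b c)" "lfun (\<lambda>a. C a b c)" "bl (C a)" "bl (\<lambda>a b. C a b c)"
  using assms by (auto simp: trilin_def bilin_def)

lemma tens3_apply: "tlf C \<Longrightarrow> tens3 scale a b c C = C a b c"
  by (simp add: tens3_def)

lemma tens3_in: "tens3 scale a b c \<in> AAA scale"
  and AAA_add: "s \<in> AAA scale \<Longrightarrow> t \<in> AAA scale \<Longrightarrow> s + t \<in> AAA scale"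
  and AAA_zero: "0 \<in> AAA scale"
proof -
  interpret t: vector_space "tsc :: 'k \<Rightarrow> (('a \<Rightarrow> 'a \<Rightarrow> 'a \<Rightarrow> 'k) \<Rightarrow> 'k) \<Rightarrow> _" by (rule tsc_vector_space)
  show "tens3 scale a b c \<in> AAA scale" "0 \<in> AAA scale"
    "s \<in> AAA scale \<Longrightarrow> t \<in> AAA scale \<Longrightarrow> s + t \<in> AAA scale"
    unfolding AAA_def by (rule t.span_base t.span_zero t.span_add; auto)+
qed

definition tensL :: "'a \<Rightarrow> ('k,'a) ten \<Rightarrow> ('k,'a) ten3" where
  "tensL a z = (\<lambda>C. if tlf C then z (\<lambda>s t. C a s t) else 0)"

definition tensR :: "('k,'a) ten \<Rightarrow> 'a \<Rightarrow> ('k,'a) ten3" where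
  "tensR z a = (\<lambda>C. if tlf C then z (\<lambda>s t. C s t a) else 0)"

lemma tensL_in: "z \<in> tensors \<Longrightarrow> tensL a z \<in> AAA scale"
proof (induction rule: tensors_induct)
  case zero
  have "tensL a 0 = 0" by (auto simp: tensL_def)
  then show ?case by (simp only: AAA_zero)
next
  case (step s t z)
  have "tensL a (tens scale s t + z) = tens3 scale a s t + tensL a z"
    by (auto simp: tensL_def tens3_def tens_apply trilinD)
  then show ?case using step by (simp only: AAA_add tens3_in)
qed

lemma tensR_in: "z \<in> tensors \<Longrightarrow> tensR z a \<in> AAA scale"
proof (induction rule: tensors_induct)
  case zero
  have "tensR 0 a = 0" by (auto simp: tensR_def)
  then show ?case by (simp only: AAA_zero)
next
  case (step s t z)
  have "tensR (tens scale s t + z) a = tens3 scale s t a + tensR z a"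
    by (auto simp: tensR_def tens3_def tens_apply trilinD)
  then show ?case using step by (simp only: AAA_add tens3_in)
qed

text \<open>The parameters stand for left or right multiplications: \<open>e\<close> for \<open>E\<close>, \<open>d\<close> for \<open>\<Delta>\<close>,
  \<open>m\<close> for the product or its opposite, and \<open>M\<close> for \<open>E\<^sup>(\<^sup>3\<^sup>)\<close>.\<close>

lemma E3_left:
  assumes e: "endo e" and d: "\<And>x. endo (d x)" and d_lin: "\<And>z B. z \<in> tensors \<Longrightarrow> lfun (\<lambda>x. d x z B)"
    and m: "\<And>f u. lfun f \<Longrightarrow> lfun (\<lambda>x. f (m x u))" "\<And>f u. lfun f \<Longrightarrow> lfun (\<lambda>x. f (m u x))"
    and ed: "e (d b (tens scale v w)) = d b (tens scale v w)"
    and M: "\<And>s. s \<in> AAA scale \<Longrightarrow> M s = e12 (e23 s)"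
    and e12: "\<And>s. e12 s = (\<lambda>C. if tlf C then s (\<lambda>a b c. e (tens scale a b) (\<lambda>x y. C x y c)) else 0)"
    and e23: "\<And>s. e23 s = (\<lambda>C. if tlf C then s (\<lambda>a b c. e (tens scale b c) (\<lambda>x y. C a x y)) else 0)"
    and D: "\<And>x s. D x s = (\<lambda>C. if tlf C then x (\<lambda>a b. s (\<lambda>c k l. d b (tens scale k l) (\<lambda>u v. C (m a c) u v))) else 0)"
    and ext: "M (D (tens scale a b) (tens3 scale u v w)) = D (e (tens scale a b)) (tens3 scale u v w)"
    and f: "lfun f" and g: "lfun g" and h: "lfun h"
  shows "br (d b (tens scale v w)) (\<lambda>s. br (e (tens scale (m a u) s)) f g) h =
    br (e (tens scale a b)) (\<lambda>p. f (m p u)) (\<lambda>q. br (d q (tens scale v w)) g h)"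
proof -
  have d_in: "d x (tens scale k l) \<in> tensors" for x k l using d by simp
  have e_in: "e (tens scale k l) \<in> tensors" for k l using e by simp
  \<comment> \<open>\<open>tens\<close> and \<open>tens3\<close> evaluate to 0 off multilinear
    forms, so each form met on the way must first be shown multilinear.\<close>
  have tl_D: "tlf (\<lambda>c k l. d y (tens scale k l) (\<lambda>u v. C (m x c) u v))" if "tlf C" for C x y
  proof (rule trilinI)
    show "lfun (\<lambda>c. d y (tens scale k l) (\<lambda>u v. C (m x c) u v))" for k l
      by (rule lin_tensors[OF d_in]) (rule trilinD(4)[OF that] m(2)[OF trilinD(3)[OF that]])+
  qed (rule lin_endo_tens[OF d])+
  have bl_D: "bl (\<lambda>x y. d y (tens scale k l) (\<lambda>u v. C (m x c) u v))" if "tlf C" for C c k l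
  proof (rule bilinI)
    show "lfun (\<lambda>x. d y (tens scale k l) (\<lambda>u v. C (m x c) u v))" for y
      by (rule lin_tensors[OF d_in]) (rule trilinD(4)[OF that] m(1)[OF trilinD(3)[OF that]])+
  qed (rule d_lin[OF tens_in])
  have D_tens: "D x (tens3 scale u v w) = (\<lambda>C. if tlf C then x (\<lambda>a b. d b (tens scale v w) (\<lambda>s t. C (m a u) s t)) else 0)" for x
    unfolding D using tl_D by (auto simp: tens3_apply)
  then have 1: "D (tens scale a b) (tens3 scale u v w) = tensL (m a u) (d b (tens scale v w))"
    unfolding tensL_def using bl_D by (auto simp: tens_apply)
  have tl_e23: "tlf (\<lambda>a b c. e (tens scale b c) (\<lambda>x y. C a x y))" if "tlf C" for C
  proof (rule trilinI)
    show "lfun (\<lambda>a. e (tens scale b c) (\<lambda>x y. C a x y))" for b c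
      by (rule lin_tensors[OF e_in]) (rule trilinD(4)[OF that] trilinD(3)[OF that])+
  qed (rule lin_endo_tens[OF e])+
  have tl_e12: "tlf (\<lambda>a b c. e (tens scale a b) (\<lambda>x y. C x y c))" if "tlf C" for C
  proof (rule trilinI)
    show "lfun (\<lambda>c. e (tens scale a b) (\<lambda>x y. C x y c))" for a b
      by (rule lin_tensors[OF e_in]) (rule trilinD(5)[OF that] trilinD(1)[OF that])+
  qed (rule lin_endo_tens[OF e])+
  \<comment> \<open>The factor E on the last two legs is absorbed, since by \<open>ed\<close> it
    fixes the value of Delta(b) sitting there.\<close>
  have 2: "e23 (tensL (m a u) (d b (tens scale v w))) = tensL (m a u) (d b (tens scale v w))"
  proof -
    have "d b (tens scale v w) (\<lambda>s t. e (tens scale s t) (C x)) = d b (tens scale v w) (C x)" if "tlf C" for C x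
      using endo_apply[OF e d_in trilinD(4)[OF that], of b v w x] unfolding ed by simp
    then have "e23 (tensL x (d b (tens scale v w))) C = tensL x (d b (tens scale v w)) C" for x C
      unfolding e23 tensL_def using tl_e23[of C] by (cases "tlf C") (simp_all only: if_True if_False)
    then show ?thesis by blast
  qed
  \<comment> \<open>What is left of \<open>ext\<close>: E acts on the first two legs of au (x)
    Delta(b)(v (x) w), and the result is id (x) Delta applied to E(a (x) b), acting on u (x) v (x)
    w.\<close>
  have *: "d b (tens scale v w) (\<lambda>s t. e (tens scale (m a u) s) (\<lambda>x y. C x y t)) =
      e (tens scale a b) (\<lambda>p q. d q (tens scale v w) (\<lambda>s t. C (m p u) s t))" if "tlf C" for C
    using fun_cong[OF ext, of C] that tl_e12[OF that]
    unfolding D_tens[of "e _"] 1 M[OF tensL_in[OF d_in]] 2 e12 by (simp add: tensL_def)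
  have C: "tlf (\<lambda>x y t. f x * g y * h t)"
    using f g h by (intro trilinI) (auto intro: lin_cmult lin_multc)
  have "e (tens scale (m a u) s) (\<lambda>x y. f x * g y * h t) = br (e (tens scale (m a u) s)) f g * h t" for s t
    unfolding br_def by (rule tensors_multc[OF e_in bilin_prod[OF f g]])
  moreover have "d q (tens scale v w) (\<lambda>s t. f (m p u) * g s * h t) = f (m p u) * br (d q (tens scale v w)) g h" for p q
    using tensors_multc[OF d_in bilin_prod[OF g h], of q v w "f (m p u)"]
    by (simp add: br_def ac_simps)
  ultimately show ?thesis
    using *[OF C] unfolding br_def[of "d b _"] br_def[of "e (tens scale a b)"] by simp
qed

text \<open>Mirror image of \<open>E3_left\<close>: Delta now fills the first two legs, so the
  factor of \<open>M\<close> on these legs has to act first in order to be absorbed. This is why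
  \<open>M\<close> is factored in the other order.\<close>

lemma E3_right:
  assumes e: "endo e" and d: "\<And>x. endo (d x)" and d_lin: "\<And>z B. z \<in> tensors \<Longrightarrow> lfun (\<lambda>x. d x z B)"
    and m: "\<And>f u. lfun f \<Longrightarrow> lfun (\<lambda>x. f (m x u))" "\<And>f u. lfun f \<Longrightarrow> lfun (\<lambda>x. f (m u x))"
    and ed: "e (d b (tens scale w v)) = d b (tens scale w v)"
    and M: "\<And>s. s \<in> AAA scale \<Longrightarrow> M s = e23 (e12 s)"
    and e12: "\<And>s. e12 s = (\<lambda>C. if tlf C then s (\<lambda>a b c. e (tens scale a b) (\<lambda>x y. C x y c)) else 0)"
    and e23: "\<And>s. e23 s = (\<lambda>C. if tlf C then s (\<lambda>a b c. e (tens scale b c) (\<lambda>x y. C a x y)) else 0)"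
    and D: "\<And>x s. D x s = (\<lambda>C. if tlf C then x (\<lambda>a b. s (\<lambda>k l c. d a (tens scale k l) (\<lambda>u v. C u v (m b c)))) else 0)"
    and ext: "M (D (tens scale b a) (tens3 scale w v u)) = D (e (tens scale b a)) (tens3 scale w v u)"
    and f: "lfun f" and g: "lfun g" and h: "lfun h"
  shows "br (d b (tens scale w v)) h (\<lambda>s. br (e (tens scale s (m a u))) g f) =
    br (e (tens scale b a)) (\<lambda>q. br (d q (tens scale w v)) h g) (\<lambda>p. f (m p u))"
proof -
  have d_in: "d x (tens scale k l) \<in> tensors" for x k l using d by simp
  have e_in: "e (tens scale k l) \<in> tensors" for k l using e by simp
  have tl_D: "tlf (\<lambda>k l c. d y (tens scale k l) (\<lambda>u v. C u v (m x c)))" if "tlf C" for C x y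
  proof (rule trilinI)
    show "lfun (\<lambda>c. d y (tens scale k l) (\<lambda>u v. C u v (m x c)))" for k l
      by (rule lin_tensors[OF d_in]) (rule trilinD(5)[OF that] m(2)[OF trilinD(1)[OF that]])+
  qed (rule lin_endo_tens[OF d])+
  have bl_D: "bl (\<lambda>y x. d y (tens scale k l) (\<lambda>u v. C u v (m x c)))" if "tlf C" for C c k l
  proof (rule bilinI)
    show "lfun (\<lambda>x. d y (tens scale k l) (\<lambda>u v. C u v (m x c)))" for y
      by (rule lin_tensors[OF d_in]) (rule trilinD(5)[OF that] m(1)[OF trilinD(1)[OF that]])+
  qed (rule d_lin[OF tens_in])
  have D_tens: "D x (tens3 scale w v u) = (\<lambda>C. if tlf C then x (\<lambda>b a. d b (tens scale w v) (\<lambda>s t. C s t (m a u))) else 0)" for x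
    unfolding D using tl_D by (auto simp: tens3_apply)
  then have 1: "D (tens scale b a) (tens3 scale w v u) = tensR (d b (tens scale w v)) (m a u)"
    unfolding tensR_def using bl_D by (auto simp: tens_apply)
  have tl_e12: "tlf (\<lambda>a b c. e (tens scale a b) (\<lambda>x y. C x y c))" if "tlf C" for C
  proof (rule trilinI)
    show "lfun (\<lambda>c. e (tens scale a b) (\<lambda>x y. C x y c))" for a b
      by (rule lin_tensors[OF e_in]) (rule trilinD(5)[OF that] trilinD(1)[OF that])+
  qed (rule lin_endo_tens[OF e])+
  have tl_e23: "tlf (\<lambda>a b c. e (tens scale b c) (\<lambda>x y. C a x y))" if "tlf C" for C
  proof (rule trilinI)
    show "lfun (\<lambda>a. e (tens scale b c) (\<lambda>x y. C a x y))" for b c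
      by (rule lin_tensors[OF e_in]) (rule trilinD(4)[OF that] trilinD(3)[OF that])+
  qed (rule lin_endo_tens[OF e])+
  have 2: "e12 (tensR (d b (tens scale w v)) (m a u)) = tensR (d b (tens scale w v)) (m a u)"
  proof -
    have "d b (tens scale w v) (\<lambda>s t. e (tens scale s t) (\<lambda>p q. C p q x)) = d b (tens scale w v) (\<lambda>p q. C p q x)"
      if "tlf C" for C x
      using endo_apply[OF e d_in trilinD(5)[OF that], of b w v x] unfolding ed by simp
    then have "e12 (tensR (d b (tens scale w v)) x) C = tensR (d b (tens scale w v)) x C" for x C
      unfolding e12 tensR_def using tl_e12[of C] by (cases "tlf C") (simp_all only: if_True if_False)
    then show ?thesis by blast
  qed
  have *: "d b (tens scale w v) (\<lambda>t s. e (tens scale s (m a u)) (\<lambda>y x. C t y x)) =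
      e (tens scale b a) (\<lambda>q p. d q (tens scale w v) (\<lambda>t s. C t s (m p u)))" if "tlf C" for C
    using fun_cong[OF ext, of C] that tl_e23[OF that]
    unfolding D_tens[of "e _"] 1 M[OF tensR_in[OF d_in]] 2 e23 by (simp add: tensR_def)
  have C: "tlf (\<lambda>t y x. h t * (g y * f x))"
    using f g h by (intro trilinI) (auto intro: lin_cmult lin_multc)
  have "e (tens scale s (m a u)) (\<lambda>y x. h t * (g y * f x)) = h t * br (e (tens scale s (m a u))) g f" for s t
    using tensors_multc[OF e_in bilin_prod[OF g f], of s "m a u" "h t"]
    by (simp add: br_def mult.commute[of "h t"])
  moreover have "d q (tens scale w v) (\<lambda>t s. h t * (g s * f (m p u))) = br (d q (tens scale w v)) h g * f (m p u)" for p q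
    using tensors_multc[OF d_in bilin_prod[OF h g], of q w v "f (m p u)"]
    by (simp add: br_def mult.assoc)
  ultimately show ?thesis
    using *[OF C] unfolding br_def[of "d b _"] br_def[of "e (tens scale b a)"] by simp
qed

end

section \<open>Multipliers of the tensor square of a non-degenerate algebra\<close>

locale nondeg_algebra = tensor_square scale
  for scale :: "'k::field \<Rightarrow> 'a::ab_group_add \<Rightarrow> 'a" +
  fixes mu :: "'a \<Rightarrow> 'a \<Rightarrow> 'a" (infixl "\<cdot>" 70)
  assumes lin_mu [simp]: "lfun f \<Longrightarrow> lfun (\<lambda>x. f (x \<cdot> u))" "lfun f \<Longrightarrow> lfun (\<lambda>x. f (u \<cdot> x))"
    and assoc: "(x \<cdot> y) \<cdot> z = x \<cdot> (y \<cdot> z)"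
    and idem: "lfun f \<Longrightarrow> (\<And>x y. f (x \<cdot> y) = 0) \<Longrightarrow> f z = 0"
    and nondeg_left: "(\<And>u. u \<cdot> x = 0) \<Longrightarrow> x = 0"
    and nondeg_right: "(\<And>u. x \<cdot> u = 0) \<Longrightarrow> x = 0"
begin

section \<open>Cancellation by non-degeneracy\<close>

lemma lin_mu_mu [simp]:
  assumes "lfun f"
  shows "lfun (\<lambda>x. f (u \<cdot> (x \<cdot> v)))" "lfun (\<lambda>x. f (u \<cdot> (v \<cdot> x)))" "lfun (\<lambda>x. f (x \<cdot> u \<cdot> v))"
  using lin_mu(1)[OF lin_mu(2)[OF assms]] lin_mu(2)[OF lin_mu(2)[OF assms]] lin_mu(1)[OF lin_mu(1)[OF assms]] .

lemma cancel_right: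
  assumes "\<And>f u. lfun f \<Longrightarrow> f (x \<cdot> u) = f (y \<cdot> u)"
  shows "x = y"
proof -
  have "(x - y) \<cdot> u = 0" for u
    by (rule separate) (use assms in \<open>auto simp: lin_zero lin_diff[OF lin_mu(1)]\<close>)
  then show ?thesis using nondeg_right by fastforce
qed

lemma cancel_left:
  assumes "\<And>f u. lfun f \<Longrightarrow> f (u \<cdot> x) = f (u \<cdot> y)"
  shows "x = y"
proof -
  have "u \<cdot> (x - y) = 0" for u
    by (rule separate) (use assms in \<open>auto simp: lin_zero lin_diff[OF lin_mu(2)]\<close>)
  then show ?thesis using nondeg_left by fastforce
qed

text \<open>Fixing the functional on one leg turns the other leg into a slice, an element of A, to
  which non-degeneracy of A applies. In this way A (x) A inherits non-degeneracy one leg at a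
  time.\<close>

lemma br_cancel:
  assumes x: "x \<in> tensors" and y: "y \<in> tensors" and f: "lfun f" and g: "lfun g"
  shows br_cancel_1r: "(\<And>f u. lfun f \<Longrightarrow> br x (\<lambda>p. f (p \<cdot> u)) g = br y (\<lambda>p. f (p \<cdot> u)) g) \<Longrightarrow> br x f g = br y f g"
    and br_cancel_1l: "(\<And>f u. lfun f \<Longrightarrow> br x (\<lambda>p. f (u \<cdot> p)) g = br y (\<lambda>p. f (u \<cdot> p)) g) \<Longrightarrow> br x f g = br y f g"
    and br_cancel_2r: "(\<And>g u. lfun g \<Longrightarrow> br x f (\<lambda>p. g (p \<cdot> u)) = br y f (\<lambda>p. g (p \<cdot> u))) \<Longrightarrow> br x f g = br y f g"
    and br_cancel_2l: "(\<And>g u. lfun g \<Longrightarrow> br x f (\<lambda>p. g (u \<cdot> p)) = br y f (\<lambda>p. g (u \<cdot> p))) \<Longrightarrow> br x f g = br y f g"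
proof -
  note slice_f = slR_apply[OF x _ g, symmetric] slR_apply[OF y _ g, symmetric]
  note slice_g = slL_apply[OF x f, symmetric] slL_apply[OF y f, symmetric]
  show "br x f g = br y f g" if "\<And>f u. lfun f \<Longrightarrow> br x (\<lambda>p. f (p \<cdot> u)) g = br y (\<lambda>p. f (p \<cdot> u)) g"
    using cancel_right[of "slR g x" "slR g y"] that f by (simp add: slice_f)
  show "br x f g = br y f g" if "\<And>f u. lfun f \<Longrightarrow> br x (\<lambda>p. f (u \<cdot> p)) g = br y (\<lambda>p. f (u \<cdot> p)) g"
    using cancel_left[of "slR g x" "slR g y"] that f by (simp add: slice_f)
  show "br x f g = br y f g" if "\<And>g u. lfun g \<Longrightarrow> br x f (\<lambda>p. g (p \<cdot> u)) = br y f (\<lambda>p. g (p \<cdot> u))"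
    using cancel_right[of "slL f x" "slL f y"] that g by (simp add: slice_g)
  show "br x f g = br y f g" if "\<And>g u. lfun g \<Longrightarrow> br x f (\<lambda>p. g (u \<cdot> p)) = br y f (\<lambda>p. g (u \<cdot> p))"
    using cancel_left[of "slL f x" "slL f y"] that g by (simp add: slice_g)
qed

lemma br_cancel_left:
  assumes "x \<in> tensors" "y \<in> tensors" "lfun f" "lfun g"
    and "\<And>f g u v. lfun f \<Longrightarrow> lfun g \<Longrightarrow> br x (\<lambda>p. f (u \<cdot> p)) (\<lambda>q. g (v \<cdot> q)) = br y (\<lambda>p. f (u \<cdot> p)) (\<lambda>q. g (v \<cdot> q))"
  shows "br x f g = br y f g"
proof (rule br_cancel_1l[OF assms(1-4)])
  fix f u assume f: "lfun f"
  show "br x (\<lambda>p. f (u \<cdot> p)) g = br y (\<lambda>p. f (u \<cdot> p)) g"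
    by (rule br_cancel_2l[OF assms(1,2) lin_mu(2)[OF f] assms(4)]) (rule assms(5)[OF f])
qed

lemma br_cancel_right:
  assumes "x \<in> tensors" "y \<in> tensors" "lfun f" "lfun g"
    and "\<And>f g u v. lfun f \<Longrightarrow> lfun g \<Longrightarrow> br x (\<lambda>p. f (p \<cdot> u)) (\<lambda>q. g (q \<cdot> v)) = br y (\<lambda>p. f (p \<cdot> u)) (\<lambda>q. g (q \<cdot> v))"
  shows "br x f g = br y f g"
proof (rule br_cancel_1r[OF assms(1-4)])
  fix f u assume f: "lfun f"
  show "br x (\<lambda>p. f (p \<cdot> u)) g = br y (\<lambda>p. f (p \<cdot> u)) g"
    by (rule br_cancel_2r[OF assms(1,2) lin_mu(1)[OF f] assms(4)]) (rule assms(5)[OF f])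
qed

lemma br_cancel_1r_2l:
  assumes "x \<in> tensors" "y \<in> tensors" "lfun f" "lfun g"
    and "\<And>f g u v. lfun f \<Longrightarrow> lfun g \<Longrightarrow> br x (\<lambda>p. f (p \<cdot> u)) (\<lambda>q. g (v \<cdot> q)) = br y (\<lambda>p. f (p \<cdot> u)) (\<lambda>q. g (v \<cdot> q))"
  shows "br x f g = br y f g"
proof (rule br_cancel_1r[OF assms(1-4)])
  fix f u assume f: "lfun f"
  show "br x (\<lambda>p. f (p \<cdot> u)) g = br y (\<lambda>p. f (p \<cdot> u)) g"
    by (rule br_cancel_2l[OF assms(1,2) lin_mu(1)[OF f] assms(4)]) (rule assms(5)[OF f])
qed

text \<open>Meant for comparing T1 with T3: in the first leg, the former is tied to Delta by a
  factor on the right, the latter by one on the left.\<close>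

lemma br_cancel_1lr:
  assumes x: "x \<in> tensors" and y: "y \<in> tensors" and f: "lfun f" and g: "lfun g"
    and *: "\<And>f u v. lfun f \<Longrightarrow> br x (\<lambda>p. f (u \<cdot> (p \<cdot> v))) g = br y (\<lambda>p. f (u \<cdot> (p \<cdot> v))) g"
  shows "br x f g = br y f g"
proof -
  have "slR g x \<cdot> v = slR g y \<cdot> v" for v
  proof (rule cancel_left)
    fix f u assume f: "lfun f"
    show "f (u \<cdot> (slR g x \<cdot> v)) = f (u \<cdot> (slR g y \<cdot> v))"
      using *[OF f, of u v] slR_apply[OF x lin_mu_mu(1)[OF f] g] slR_apply[OF y lin_mu_mu(1)[OF f] g] by simp
  qed
  then have "slR g x = slR g y" by (intro cancel_right) simp
  then show ?thesis using slR_apply[OF x f g] slR_apply[OF y f g] by simp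
qed

text \<open>Needed for tensors given only implicitly, like T1: additivity and homogeneity are
  checked on right multiples of the slice and then cancelled.\<close>

lemma lin_cancel_1r:
  assumes X: "\<And>t. X t \<in> tensors" and f: "lfun f" and g: "lfun g"
    and *: "\<And>f u. lfun f \<Longrightarrow> lfun (\<lambda>t. br (X t) (\<lambda>p. f (p \<cdot> u)) g)"
  shows "lfun (\<lambda>t. br (X t) f g)"
proof -
  have sl: "f (slR g (X t) \<cdot> u) = br (X t) (\<lambda>p. f (p \<cdot> u)) g" if "lfun f" for f t u
    by (rule slR_apply[OF X lin_mu(1)[OF that] g])
  have "slR g (X (s + t)) = slR g (X s) + slR g (X t)" for s t
    by (rule cancel_right) (simp add: sl linD(1)[OF *] linD(1)[OF lin_mu(1)])
  moreover have "slR g (X (scale c t)) = scale c (slR g (X t))" for c t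
    by (rule cancel_right) (simp add: sl linD(2)[OF *] linD(2)[OF lin_mu(1)])
  ultimately show ?thesis
    using f X g by (simp add: lin_iff flip: slR_apply)
qed

text \<open>The left action of a multiplier commutes with right multiplication: after multiplying by
  c (x) d from the left, \<open>compat\<close> moves the action to the other side, where
  associativity applies.\<close>

lemma multiplier_module:
  assumes mem: "\<And>a b. M a b \<in> tensors" "\<And>a b. N a b \<in> tensors"
    and compat: "\<And>a b c d f g. lfun f \<Longrightarrow> lfun g \<Longrightarrow>
      br (M a b) (\<lambda>p. f (c \<cdot> p)) (\<lambda>q. g (d \<cdot> q)) = br (N c d) (\<lambda>p. f (p \<cdot> a)) (\<lambda>q. g (q \<cdot> b))"
    and f: "lfun f" and g: "lfun g"
  shows "br (M (a \<cdot> c) b) f g = br (M a b) (\<lambda>p. f (p \<cdot> c)) g"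
    and "br (M a (b \<cdot> c)) f g = br (M a b) f (\<lambda>p. g (p \<cdot> c))"
proof -
  have "br (M (a \<cdot> c) b) f g = br (map_tens (\<lambda>p. p \<cdot> c) (\<lambda>q. q) (M a b)) f g"
  proof (rule br_cancel_left)
    fix f g u v assume "lfun f" "lfun g"
    then show "br (M (a \<cdot> c) b) (\<lambda>p. f (u \<cdot> p)) (\<lambda>q. g (v \<cdot> q)) =
        br (map_tens (\<lambda>p. p \<cdot> c) (\<lambda>q. q) (M a b)) (\<lambda>p. f (u \<cdot> p)) (\<lambda>q. g (v \<cdot> q))"
      using compat[of "\<lambda>p. f (p \<cdot> c)" g a b u v] by (simp add: br_map_tens compat assoc)
  qed (simp_all add: mem f g)
  then show "br (M (a \<cdot> c) b) f g = br (M a b) (\<lambda>p. f (p \<cdot> c)) g"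
    using f g by (simp add: br_map_tens)
  have "br (M a (b \<cdot> c)) f g = br (map_tens (\<lambda>p. p) (\<lambda>q. q \<cdot> c) (M a b)) f g"
  proof (rule br_cancel_left)
    fix f g u v assume "lfun f" "lfun g"
    then show "br (M a (b \<cdot> c)) (\<lambda>p. f (u \<cdot> p)) (\<lambda>q. g (v \<cdot> q)) =
        br (map_tens (\<lambda>p. p) (\<lambda>q. q \<cdot> c) (M a b)) (\<lambda>p. f (u \<cdot> p)) (\<lambda>q. g (v \<cdot> q))"
      using compat[of f "\<lambda>q. g (q \<cdot> c)" a b u v] by (simp add: br_map_tens compat assoc)
  qed (simp_all add: mem f g)
  then show "br (M a (b \<cdot> c)) f g = br (M a b) f (\<lambda>p. g (p \<cdot> c))"
    using f g by (simp add: br_map_tens)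
qed

section \<open>Products in A (x) A\<close>

lemma bilin_compose:
  assumes "bl B" "\<And>f. lfun f \<Longrightarrow> lfun (\<lambda>p. f (h p))" "\<And>f. lfun f \<Longrightarrow> lfun (\<lambda>q. f (k q))"
  shows "bl (\<lambda>p q. B (h p) (k q))"
proof (rule bilinI)
  show "lfun (\<lambda>q. B (h p) (k q))" for p by (rule assms(3)[OF bilinD(1)[OF assms(1)]])
  show "lfun (\<lambda>p. B (h p) (k q))" for q by (rule assms(2)[OF bilinD(2)[OF assms(1)]])
qed

lemma bilin_mu:
  assumes "bl B"
  shows "bl (\<lambda>p q. B (u \<cdot> p) (v \<cdot> q))"
    and "bl (\<lambda>p q. B (u \<cdot> p) q)" "bl (\<lambda>p q. B (p \<cdot> u) q)"
    and "bl (\<lambda>p q. B p (u \<cdot> q))" "bl (\<lambda>p q. B p (q \<cdot> u))"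
  using bilin_compose[OF assms, where h = "\<lambda>p. u \<cdot> p" and k = "\<lambda>q. v \<cdot> q"]
    bilin_compose[OF assms, where h = "\<lambda>p. u \<cdot> p" and k = "\<lambda>q. q"]
    bilin_compose[OF assms, where h = "\<lambda>p. p \<cdot> u" and k = "\<lambda>q. q"]
    bilin_compose[OF assms, where h = "\<lambda>p. p" and k = "\<lambda>q. u \<cdot> q"]
    bilin_compose[OF assms, where h = "\<lambda>p. p" and k = "\<lambda>q. q \<cdot> u"]
  by simp_all

lemma tmult_tens_right:
  assumes "x \<in> tensors"
  shows "tmult scale mu x (tens scale u v) = map_tens (\<lambda>p. p \<cdot> u) (\<lambda>q. q \<cdot> v) x"
proof
  fix B
  have "tens scale u v (\<lambda>c d. B (a \<cdot> c) (b \<cdot> d)) = B (a \<cdot> u) (b \<cdot> v)" if "bl B" for a b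
    by (rule tens_apply, rule bilin_mu(1)[OF that])
  then show "tmult scale mu x (tens scale u v) B = map_tens (\<lambda>p. p \<cdot> u) (\<lambda>q. q \<cdot> v) x B"
    by (simp add: tmult_def map_tens_def)
qed

lemma tmult_tens_left:
  assumes x: "x \<in> tensors"
  shows "tmult scale mu (tens scale u v) x = map_tens (\<lambda>p. u \<cdot> p) (\<lambda>q. v \<cdot> q) x"
proof
  fix B
  have "tens scale u v (\<lambda>a b. x (\<lambda>c d. B (a \<cdot> c) (b \<cdot> d))) = x (\<lambda>c d. B (u \<cdot> c) (v \<cdot> d))" if "bl B"
  proof (rule tens_apply, rule bilinI)
    show "lfun (\<lambda>b. x (\<lambda>c d. B (a \<cdot> c) (b \<cdot> d)))" for a
      by (rule lin_tensors[OF x], rule bilin_mu(1)[OF that],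
          rule lin_mu(1)[OF bilinD(1)[OF that]])
    show "lfun (\<lambda>a. x (\<lambda>c d. B (a \<cdot> c) (b \<cdot> d)))" for b
      by (rule lin_tensors[OF x], rule bilin_mu(1)[OF that],
          rule lin_mu(1)[OF bilinD(2)[OF that]])
  qed
  then show "tmult scale mu (tens scale u v) x B = map_tens (\<lambda>p. u \<cdot> p) (\<lambda>q. v \<cdot> q) x B"
    by (simp add: tmult_def map_tens_def)
qed

lemma br_tmult_tens:
  assumes "x \<in> tensors" "lfun f" "lfun g"
  shows "br (tmult scale mu x (tens scale u v)) f g = br x (\<lambda>p. f (p \<cdot> u)) (\<lambda>q. g (q \<cdot> v))"
    and "br (tmult scale mu (tens scale u v) x) f g = br x (\<lambda>p. f (u \<cdot> p)) (\<lambda>q. g (v \<cdot> q))"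
  using assms by (simp_all add: tmult_tens_left tmult_tens_right br_map_tens)

lemma tmult_cancel_left:
  assumes x: "x \<in> tensors" and y: "y \<in> tensors"
    and eq: "\<And>u v. tmult scale mu (tens scale u v) x = tmult scale mu (tens scale u v) y"
  shows "x = y"
proof (rule prod_forms_suffice[OF x y], rule br_cancel_left[OF x y])
  show "br x (\<lambda>p. f (u \<cdot> p)) (\<lambda>q. g (v \<cdot> q)) = br y (\<lambda>p. f (u \<cdot> p)) (\<lambda>q. g (v \<cdot> q))"
    if "lfun f" "lfun g" for f g u v
    using eq[of u v] that x y by (simp flip: br_tmult_tens)
qed

lemma tmult_cancel_right:
  assumes x: "x \<in> tensors" and y: "y \<in> tensors"
    and eq: "\<And>u v. tmult scale mu x (tens scale u v) = tmult scale mu y (tens scale u v)"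
  shows "x = y"
proof (rule prod_forms_suffice[OF x y], rule br_cancel_right[OF x y])
  show "br x (\<lambda>p. f (p \<cdot> u)) (\<lambda>q. g (q \<cdot> v)) = br y (\<lambda>p. f (p \<cdot> u)) (\<lambda>q. g (q \<cdot> v))"
    if "lfun f" "lfun g" for f g u v
    using eq[of u v] that x y by (simp flip: br_tmult_tens)
qed

text \<open>Non-degeneracy of A (x) A makes A (x) A embed into its multipliers; hence the
  descriptions defining the maps T_i denote.\<close>

lemma mis_unique: "mis scale mu M x \<Longrightarrow> mis scale mu M y \<Longrightarrow> x = y"
  unfolding mis_def by (rule tmult_cancel_right) (auto simp: tens_in)

lemma mis_The: "\<exists>x. mis scale mu M x \<Longrightarrow> mis scale mu M (THE x. mis scale mu M x)"
  using mis_unique by (metis theI)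

lemma br_mis:
  assumes "mis scale mu M x" "lfun f" "lfun g"
  shows "br (fst M (tens scale u v)) f g = br x (\<lambda>p. f (p \<cdot> u)) (\<lambda>q. g (q \<cdot> v))"
    and "br (snd M (tens scale u v)) f g = br x (\<lambda>p. f (u \<cdot> p)) (\<lambda>q. g (v \<cdot> q))"
  using assms by (simp_all add: mis_def br_tmult_tens)

lemma one_t_tens:
  "fst (one_t scale mu b) (tens scale u v) = tens scale u (b \<cdot> v)"
  "snd (one_t scale mu b) (tens scale u v) = tens scale u (v \<cdot> b)"
  by (rule ext; simp add: one_t_def tens_def bilin_mu)+

lemma t_one_tens:
  "fst (t_one scale mu a) (tens scale u v) = tens scale (a \<cdot> u) v"
  "snd (t_one scale mu a) (tens scale u v) = tens scale (u \<cdot> a) v"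
  by (rule ext; simp add: t_one_def tens_def bilin_mu)+

lemma is_mult_endo: "is_mult scale mu M \<Longrightarrow> endo (fst M)" "is_mult scale mu M \<Longrightarrow> endo (snd M)"
  by (auto simp: is_mult_def endo_def)

lemma is_mult_tmult:
  "is_mult scale mu M \<Longrightarrow> x \<in> tensors \<Longrightarrow> y \<in> tensors \<Longrightarrow> tmult scale mu x (fst M y) = tmult scale mu (snd M x) y"
  by (simp add: is_mult_def)

lemma is_mult_br:
  assumes M: "is_mult scale mu M" and f: "lfun f" and g: "lfun g"
  shows "br (fst M (tens scale a b)) (\<lambda>p. f (c \<cdot> p)) (\<lambda>q. g (d \<cdot> q)) =
    br (snd M (tens scale c d)) (\<lambda>p. f (p \<cdot> a)) (\<lambda>q. g (q \<cdot> b))"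
  using is_mult_tmult[OF M tens_in tens_in, of c d a b] f g is_mult_endo[OF M]
  by (simp flip: br_tmult_tens)

end

section \<open>Weak bialgebras in terms of slices\<close>

text \<open>In this locale \<open>El a b\<close> and \<open>Er a b\<close> are \<open>E(a \<otimes> b)\<close> and \<open>(a \<otimes> b)E\<close>, \<open>Dl x a b\<close> and \<open>Dr x a b\<close> are
  \<open>\<Delta>(x)(a \<otimes> b)\<close> and \<open>(a \<otimes> b)\<Delta>(x)\<close>, and \<open>Si\<close> is the map \<open>T\<^sub>i\<close>.  The last four assumptions are axiom (v),
  evaluated on product forms from the left or the right.  The set of assumptions is closed under
  passing to the opposite and to the coopposite structure.\<close>

locale weak_bialgebra_data = nondeg_algebra scale mu
  for scale :: "'k::field \<Rightarrow> 'a::ab_group_add \<Rightarrow> 'a" and mu (infixl "\<cdot>" 70) +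
  fixes El Er :: "'a \<Rightarrow> 'a \<Rightarrow> ('k,'a) ten"
    and Dl Dr :: "'a \<Rightarrow> 'a \<Rightarrow> 'a \<Rightarrow> ('k,'a) ten"
    and S1 S2 S3 S4 :: "'a \<Rightarrow> 'a \<Rightarrow> ('k,'a) ten"
  assumes El_in [simp]: "El a b \<in> tensors" and Er_in [simp]: "Er a b \<in> tensors"
    and Dl_in [simp]: "Dl x a b \<in> tensors" and Dr_in [simp]: "Dr x a b \<in> tensors"
    and S1_in [simp]: "S1 a b \<in> tensors" and S2_in [simp]: "S2 a b \<in> tensors"
    and S3_in [simp]: "S3 a b \<in> tensors" and S4_in [simp]: "S4 a b \<in> tensors"
    and lin_El: "lfun f \<Longrightarrow> lfun g \<Longrightarrow> lfun (\<lambda>a. br (El a b) f g)" "lfun f \<Longrightarrow> lfun g \<Longrightarrow> lfun (\<lambda>b. br (El a b) f g)"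
    and lin_Er: "lfun f \<Longrightarrow> lfun g \<Longrightarrow> lfun (\<lambda>a. br (Er a b) f g)" "lfun f \<Longrightarrow> lfun g \<Longrightarrow> lfun (\<lambda>b. br (Er a b) f g)"
    and lin_Dl: "lfun f \<Longrightarrow> lfun g \<Longrightarrow> lfun (\<lambda>x. br (Dl x a b) f g)"
      "lfun f \<Longrightarrow> lfun g \<Longrightarrow> lfun (\<lambda>a. br (Dl x a b) f g)" "lfun f \<Longrightarrow> lfun g \<Longrightarrow> lfun (\<lambda>b. br (Dl x a b) f g)"
    and lin_Dr: "lfun f \<Longrightarrow> lfun g \<Longrightarrow> lfun (\<lambda>x. br (Dr x a b) f g)"
      "lfun f \<Longrightarrow> lfun g \<Longrightarrow> lfun (\<lambda>a. br (Dr x a b) f g)" "lfun f \<Longrightarrow> lfun g \<Longrightarrow> lfun (\<lambda>b. br (Dr x a b) f g)"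
    and E_mult: "lfun f \<Longrightarrow> lfun g \<Longrightarrow>
      br (El a b) (\<lambda>p. f (c \<cdot> p)) (\<lambda>q. g (d \<cdot> q)) = br (Er c d) (\<lambda>p. f (p \<cdot> a)) (\<lambda>q. g (q \<cdot> b))"
    and D_mult: "lfun f \<Longrightarrow> lfun g \<Longrightarrow>
      br (Dl x a b) (\<lambda>p. f (c \<cdot> p)) (\<lambda>q. g (d \<cdot> q)) = br (Dr x c d) (\<lambda>p. f (p \<cdot> a)) (\<lambda>q. g (q \<cdot> b))"
    and E_Dl: "lfun f \<Longrightarrow> lfun g \<Longrightarrow> Dl x a b (\<lambda>p q. br (El p q) f g) = br (Dl x a b) f g"
    and Dr_E: "lfun f \<Longrightarrow> lfun g \<Longrightarrow> Dr x a b (\<lambda>p q. br (Er p q) f g) = br (Dr x a b) f g"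
    and Dl_E: "lfun f \<Longrightarrow> lfun g \<Longrightarrow> El a b (\<lambda>p q. br (Dl x p q) f g) = br (Dl x a b) f g"
    and E_Dr: "lfun f \<Longrightarrow> lfun g \<Longrightarrow> Er a b (\<lambda>p q. br (Dr x p q) f g) = br (Dr x a b) f g"
    and S1: "lfun f \<Longrightarrow> lfun g \<Longrightarrow> br (Dl a u (b \<cdot> v)) f g = br (S1 a b) (\<lambda>p. f (p \<cdot> u)) (\<lambda>q. g (q \<cdot> v))"
    and S2: "lfun f \<Longrightarrow> lfun g \<Longrightarrow> br (Dr b (u \<cdot> a) v) f g = br (S2 a b) (\<lambda>p. f (u \<cdot> p)) (\<lambda>q. g (v \<cdot> q))"
    and S3: "lfun f \<Longrightarrow> lfun g \<Longrightarrow> br (Dr a u (v \<cdot> b)) f g = br (S3 a b) (\<lambda>p. f (u \<cdot> p)) (\<lambda>q. g (v \<cdot> q))"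
    and S4: "lfun f \<Longrightarrow> lfun g \<Longrightarrow> br (Dl b (a \<cdot> u) v) f g = br (S4 a b) (\<lambda>p. f (p \<cdot> u)) (\<lambda>q. g (q \<cdot> v))"
    and E3_ll: "lfun f \<Longrightarrow> lfun g \<Longrightarrow> lfun h \<Longrightarrow>
      br (Dl b v w) (\<lambda>s. br (El (a \<cdot> u) s) f g) h = br (El a b) (\<lambda>p. f (p \<cdot> u)) (\<lambda>q. br (Dl q v w) g h)"
    and E3_lr: "lfun f \<Longrightarrow> lfun g \<Longrightarrow> lfun h \<Longrightarrow>
      br (Dr b v w) (\<lambda>s. br (Er (u \<cdot> a) s) f g) h = br (Er a b) (\<lambda>p. f (u \<cdot> p)) (\<lambda>q. br (Dr q v w) g h)"
    and E3_rl: "lfun f \<Longrightarrow> lfun g \<Longrightarrow> lfun h \<Longrightarrow>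
      br (Dl b w v) h (\<lambda>s. br (El s (a \<cdot> u)) g f) = br (El b a) (\<lambda>q. br (Dl q w v) h g) (\<lambda>p. f (p \<cdot> u))"
    and E3_rr: "lfun f \<Longrightarrow> lfun g \<Longrightarrow> lfun h \<Longrightarrow>
      br (Dr b w v) h (\<lambda>s. br (Er s (u \<cdot> a)) g f) = br (Er b a) (\<lambda>q. br (Dr q w v) h g) (\<lambda>p. f (u \<cdot> p))"
begin

section \<open>Opposite and coopposite structures\<close>

lemma op_nondeg: "nondeg_algebra scale (\<lambda>a b. b \<cdot> a)"
proof
  show "f z = 0" if "lfun f" "\<And>x y. f (y \<cdot> x) = 0" for f z
    using idem[OF that(1)] that(2) by blast
  show "x = 0" if "\<And>u. x \<cdot> u = 0" for x
    using nondeg_right that by blast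
  show "x = 0" if "\<And>u. u \<cdot> x = 0" for x
    using nondeg_left that by blast
qed (simp_all add: assoc)

text \<open>Reversing the product exchanges left and right actions, hence T1 with T3 and T2 with
  T4.\<close>

lemma op: "weak_bialgebra_data scale (\<lambda>a b. b \<cdot> a) Er El Dr Dl S3 S4 S1 S2"
  by (intro weak_bialgebra_data.intro weak_bialgebra_data_axioms.intro op_nondeg;
      (rule El_in Er_in Dl_in Dr_in S1_in S2_in S3_in S4_in lin_El lin_Er lin_Dl lin_Dr
        E_mult[symmetric] D_mult[symmetric] E_Dl Dr_E Dl_E E_Dr S1 S2 S3 S4
        E3_ll E3_lr E3_rl E3_rr; assumption))

text \<open>Flipping the legs turns Delta(a)(b (x) 1) into the coopposite of Delta(a) times 1 (x) b.
  So T4 with exchanged arguments, flipped, becomes the new T1; likewise T3 becomes the new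
  T2.\<close>

lemma coop: "weak_bialgebra_data scale mu (\<lambda>a b. flip (El b a)) (\<lambda>a b. flip (Er b a))
    (\<lambda>x a b. flip (Dl x b a)) (\<lambda>x a b. flip (Dr x b a))
    (\<lambda>a b. flip (S4 b a)) (\<lambda>a b. flip (S3 b a)) (\<lambda>a b. flip (S2 b a)) (\<lambda>a b. flip (S1 b a))"
proof -
  have flip_apply: "flip x (\<lambda>p q. br (F p q) f g) = x (\<lambda>p q. br (F q p) f g)" for x :: "('k,'a) ten" and F f g
    by (simp add: flip_def)
  show ?thesis
    by (intro weak_bialgebra_data.intro weak_bialgebra_data_axioms.intro nondeg_algebra_axioms;
      (simp only: br_flip flip_apply)?;
      (rule flip_in El_in Er_in Dl_in Dr_in S1_in S2_in S3_in S4_in lin_El lin_Er lin_Dl lin_Dr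
        E_mult D_mult E_Dl Dr_E Dl_E E_Dr S1 S2 S3 S4
        E3_ll E3_lr E3_rl E3_rr; assumption | rule flip_in, rule El_in Er_in Dl_in Dr_in S1_in S2_in S3_in S4_in))
qed

section \<open>Relations between the maps T_i\<close>

lemma El_module:
  assumes "lfun f" "lfun g"
  shows "br (El (a \<cdot> c) b) f g = br (El a b) (\<lambda>p. f (p \<cdot> c)) g"
    and "br (El a (b \<cdot> c)) f g = br (El a b) f (\<lambda>p. g (p \<cdot> c))"
  by (rule multiplier_module[where M = "El" and N = "Er"]; (rule E_mult)?; simp add: assms)+

lemma Dl_module:
  assumes "lfun f" "lfun g"
  shows "br (Dl x (a \<cdot> c) b) f g = br (Dl x a b) (\<lambda>p. f (p \<cdot> c)) g"
    and "br (Dl x a (b \<cdot> c)) f g = br (Dl x a b) f (\<lambda>p. g (p \<cdot> c))"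
  by (rule multiplier_module[where M = "Dl x" and N = "Dr x"]; (rule D_mult)?; simp add: assms)+

text \<open>T1(a (x) b)(u (x) 1) = Delta(a)(u (x) b): the module property extracts the extra factor
  of the second leg in assumption \<open>S1\<close>, and non-degeneracy cancels it.\<close>

lemma S1_right:
  assumes f: "lfun f" and g: "lfun g"
  shows "br (S1 a b) (\<lambda>p. f (p \<cdot> u)) g = br (Dl a u b) f g"
proof -
  have "br (map_tens (\<lambda>p. p \<cdot> u) (\<lambda>q. q) (S1 a b)) f g = br (Dl a u b) f g"
    by (rule br_cancel_2r) (use f g in \<open>simp_all add: br_map_tens S1[symmetric] Dl_module\<close>)
  then show ?thesis using f g by (simp add: br_map_tens)
qed

text \<open>Reversing both product and legs lets T2, with exchanged arguments, take the place of
  T1.\<close>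

lemmas S2_left = weak_bialgebra_data.S1_right[OF weak_bialgebra_data.coop[OF op], unfolded br_flip]

lemma lin_S1:
  assumes "lfun f" "lfun g"
  shows "lfun (\<lambda>a. br (S1 a b) f g)" "lfun (\<lambda>b. br (S1 a b) f g)"
  by (rule lin_cancel_1r; use assms in \<open>simp add: S1_right lin_Dl\<close>)+

lemmas S4_right = weak_bialgebra_data.S1_right[OF coop, unfolded br_flip]
lemmas S3_left = weak_bialgebra_data.S1_right[OF op]

text \<open>Both sides are (1 (x) d) Delta(a) (1 (x) c) evaluated on f (x) g.\<close>

lemma S1_S3:
  assumes f: "lfun f" and g: "lfun g"
  shows "br (S1 a c) f (\<lambda>q. g (d \<cdot> q)) = br (S3 a d) f (\<lambda>q. g (q \<cdot> c))"
proof -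
  have "br (map_tens (\<lambda>p. p) (\<lambda>q. d \<cdot> q) (S1 a c)) f g = br (map_tens (\<lambda>p. p) (\<lambda>q. q \<cdot> c) (S3 a d)) f g"
  \<comment> \<open>The factor \<open>w\<close> on the right exposes Delta(a) in T1, the factor
    \<open>u\<close> on the left exposes it in T3; \<open>D_mult\<close> then says that the two
    actions of Delta(a) are compatible.\<close>
  proof (rule br_cancel_1lr)
    fix f u w assume f: "lfun f"
    then show "br (map_tens (\<lambda>p. p) (\<lambda>q. d \<cdot> q) (S1 a c)) (\<lambda>p. f (u \<cdot> (p \<cdot> w))) g =
        br (map_tens (\<lambda>p. p) (\<lambda>q. q \<cdot> c) (S3 a d)) (\<lambda>p. f (u \<cdot> (p \<cdot> w))) g"
      using g D_mult[of "f" g a w c u d] S1_right[of "\<lambda>p. f (u \<cdot> p)"] S3_left[of "\<lambda>p. f (p \<cdot> w)", symmetric]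
      by (simp add: br_map_tens assoc)
  qed (simp_all add: f g)
  then show ?thesis using f g by (simp add: br_map_tens)
qed

text \<open>Apply eps to the first leg of (1 (x) b) Delta(a) (1 (x) c), read once through T3 and
  once through T1, and cancel c.\<close>

lemma counit_S3_if_S1:
  assumes eps: "lfun eps" and counit: "\<And>a b. slL eps (S1 a b) = a \<cdot> b"
  shows "slL eps (S3 a b) = b \<cdot> a"
proof (rule cancel_right)
  fix g c assume g: "lfun g"
  have "g (slL eps (S3 a b) \<cdot> c) = br (S3 a b) eps (\<lambda>q. g (q \<cdot> c))"
    by (rule slL_apply[OF S3_in eps lin_mu(1)[OF g]])
  also have "\<dots> = br (S1 a c) eps (\<lambda>q. g (b \<cdot> q))"
    by (rule S1_S3[OF eps g, symmetric])
  also have "\<dots> = g (b \<cdot> slL eps (S1 a c))"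
    by (rule slL_apply[OF S1_in eps lin_mu(2)[OF g], symmetric])
  finally show "g (slL eps (S3 a b) \<cdot> c) = g (b \<cdot> a \<cdot> c)"
    by (simp add: counit assoc)
qed

lemmas counit_S4_if_S2 =
  weak_bialgebra_data.counit_S3_if_S1[OF weak_bialgebra_data.coop[OF op], unfolded sl1_flip]

text \<open>Both sides are (v (x) 1) Delta(c) (1 (x) a) evaluated on f (x) g.\<close>

lemma S2_S1:
  assumes f: "lfun f" and g: "lfun g"
  shows "br (S2 v c) f (\<lambda>q. g (q \<cdot> a)) = br (S1 c a) (\<lambda>p. f (v \<cdot> p)) g"
proof -
  have "br (map_tens (\<lambda>p. p) (\<lambda>q. q \<cdot> a) (S2 v c)) f g = br (map_tens (\<lambda>p. v \<cdot> p) (\<lambda>q. q) (S1 c a)) f g"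
  proof (rule br_cancel_1r_2l)
    fix f g u w assume f: "lfun f" and g: "lfun g"
    then show "br (map_tens (\<lambda>p. p) (\<lambda>q. q \<cdot> a) (S2 v c)) (\<lambda>p. f (p \<cdot> u)) (\<lambda>q. g (w \<cdot> q)) =
        br (map_tens (\<lambda>p. v \<cdot> p) (\<lambda>q. q) (S1 c a)) (\<lambda>p. f (p \<cdot> u)) (\<lambda>q. g (w \<cdot> q))"
      using D_mult[of f g c u a v w] S1_right[of "\<lambda>p. f (v \<cdot> p)" "\<lambda>q. g (w \<cdot> q)"]
        S2_left[of "\<lambda>q. g (q \<cdot> a)" "\<lambda>p. f (p \<cdot> u)"]
      by (simp add: br_map_tens assoc)
  qed (simp_all add: f g)
  then show ?thesis using f g by (simp add: br_map_tens)
qed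

text \<open>This is (E (x) 1)(a (x) T1(b (x) c)) = (id (x) T1)(E(a (x) b) (x) c) on f (x) g (x) h,
  that is, \<open>E3_ll\<close> freed from its auxiliary factors. Slices by \<open>h\<close> and
  \<open>f\<close> avoid threefold tensors.\<close>

lemma E3_slices:
  assumes f: "lfun f" and g: "lfun g" and h: "lfun h"
  shows "br (El a (slR h (S1 b c))) f g = br (S1 (slL f (El a b)) c) g h"
proof -
  \<comment> \<open>Collapses the last two legs, so that the right-hand side becomes a functional on
    the first leg of E(a (x) b).\<close>
  define \<psi> where "\<psi> y = br (S1 y c) g h" for y
  have \<psi>: "lfun \<psi>" unfolding \<psi>_def using g h by (rule lin_S1)
  have *: "br (El a (slR h (S1 b c))) (\<lambda>p. f (p \<cdot> u)) (\<lambda>q. g (q \<cdot> v))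
      = br (S1 (slL (\<lambda>p. f (p \<cdot> u)) (El a b)) c) (\<lambda>q. g (q \<cdot> v)) h"
    if f: "lfun f" and g: "lfun g" for f g u v
  proof -
    have l1: "lfun (\<lambda>s. br (El (a \<cdot> u) s) f g)" and l2: "lfun (\<lambda>q. br (Dl q v c) g h)"
      using f g h by (simp_all add: lin_El lin_Dl)
    have "br (El a (slR h (S1 b c))) (\<lambda>p. f (p \<cdot> u)) (\<lambda>q. g (q \<cdot> v)) =
        br (S1 b c) (\<lambda>s. br (El a s) (\<lambda>p. f (p \<cdot> u)) (\<lambda>q. g (q \<cdot> v))) h"
      using f g h by (simp add: slR_apply[where f = "\<lambda>s. br (El a s) _ _"] lin_El)
    also have "\<dots> = br (S1 b c) (\<lambda>s. br (El (a \<cdot> u) (s \<cdot> v)) f g) h"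
      using f g by (simp add: El_module)
    also have "\<dots> = br (Dl b v c) (\<lambda>s. br (El (a \<cdot> u) s) f g) h"
      by (rule S1_right[OF l1 h])
    also have "\<dots> = br (El a b) (\<lambda>p. f (p \<cdot> u)) (\<lambda>q. br (Dl q v c) g h)"
      using f g h by (rule E3_ll)
    also have "\<dots> = br (Dl (slL (\<lambda>p. f (p \<cdot> u)) (El a b)) v c) g h"
      using slL_apply[OF El_in lin_mu(1)[OF f] l2] by simp
    also have "\<dots> = br (S1 (slL (\<lambda>p. f (p \<cdot> u)) (El a b)) c) (\<lambda>q. g (q \<cdot> v)) h"
      using g h by (simp add: S1_right)
    finally show ?thesis .
  qed
  \<comment> \<open>With the outer legs sliced, \<open>v\<close> is cancelled in the middle leg.
    Only then is \<open>g\<close> applied, which leaves \<open>u\<close> to be cancelled in the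
    first leg.\<close>
  have **: "f (slR g (El a (slR h (S1 b c))) \<cdot> u) = f (slR \<psi> (El a b) \<cdot> u)" if f: "lfun f" for f u
  proof -
    have "slL (\<lambda>p. f (p \<cdot> u)) (El a (slR h (S1 b c))) = slR h (S1 (slL (\<lambda>p. f (p \<cdot> u)) (El a b)) c)"
      using *[OF f] f h by (intro cancel_right)
        (simp add: slL_apply[where g = "\<lambda>q. _ (q \<cdot> _)"] slR_apply[where f = "\<lambda>q. _ (q \<cdot> _)"])
    then have "br (El a (slR h (S1 b c))) (\<lambda>p. f (p \<cdot> u)) g = \<psi> (slL (\<lambda>p. f (p \<cdot> u)) (El a b))"
      unfolding \<psi>_def
      by (simp only: slL_apply[OF El_in lin_mu(1)[OF f] g, symmetric] slR_apply[OF S1_in g h, symmetric])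
    then show ?thesis
      using f g \<psi> by (simp add: slL_apply slR_apply[where f = "\<lambda>q. _ (q \<cdot> _)"])
  qed
  have "slR g (El a (slR h (S1 b c))) = slR \<psi> (El a b)"
    by (rule cancel_right) (rule **)
  then have "br (El a (slR h (S1 b c))) f g = \<psi> (slL f (El a b))"
    using f g \<psi> by (simp add: slL_apply flip: slR_apply)
  then show ?thesis by (simp add: \<psi>_def)
qed

end

text \<open>All four counit identities are assumed so that this locale, too, is closed under
  \<open>op\<close> and \<open>coop\<close>. Axiom (vi) enters through explicit multiplier
  hypotheses of the lemmas.\<close>

locale weak_bialgebra = weak_bialgebra_data scale mu El Er Dl Dr S1 S2 S3 S4
  for scale :: "'k::field \<Rightarrow> 'a::ab_group_add \<Rightarrow> 'a" and mu (infixl "\<cdot>" 70)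
    and El Er Dl Dr S1 S2 S3 S4 +
  fixes eps :: "'a \<Rightarrow> 'k"
  assumes lin_eps [simp]: "lfun eps"
    and counit_S1: "slL eps (S1 a b) = a \<cdot> b"
    and counit_S2: "slR eps (S2 a b) = a \<cdot> b"
    and counit_S3: "slL eps (S3 a b) = b \<cdot> a"
    and counit_S4: "slR eps (S4 a b) = b \<cdot> a"
begin

lemma opposite: "weak_bialgebra scale (\<lambda>a b. b \<cdot> a) Er El Dr Dl S3 S4 S1 S2 eps"
  by (intro weak_bialgebra.intro weak_bialgebra_axioms.intro op
      lin_eps counit_S1 counit_S2 counit_S3 counit_S4)

lemma coopposite: "weak_bialgebra scale mu (\<lambda>a b. flip (El b a)) (\<lambda>a b. flip (Er b a))
    (\<lambda>x a b. flip (Dl x b a)) (\<lambda>x a b. flip (Dr x b a))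
    (\<lambda>a b. flip (S4 b a)) (\<lambda>a b. flip (S3 b a)) (\<lambda>a b. flip (S2 b a)) (\<lambda>a b. flip (S1 b a)) eps"
  by (intro weak_bialgebra.intro weak_bialgebra_axioms.intro coop;
      simp add: counit_S1 counit_S2 counit_S3 counit_S4)

lemmas biopposite = weak_bialgebra.coopposite[OF opposite]

text \<open>Sweedler form: \<open>E(1 \<otimes> bc)\<close> equals the barred \<open>\<Pi>\<^sup>R(b\<^sub>1)\<close> tensored with \<open>b\<^sub>2c\<close>.\<close>

lemma slR_El_mult:
  assumes g: "lfun g"
  shows "slR g (El a (b \<cdot> c)) = slR eps (El a (slR g (S1 b c)))"
proof (rule separate)
  fix f assume f: "lfun f"
  \<comment> \<open>Axiom (v) with eps on the middle leg; the counit then turns T1 into the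
    product.\<close>
  have "f (slR eps (El a (slR g (S1 b c)))) = br (S1 (slL f (El a b)) c) eps g"
    using f g by (simp add: slR_apply E3_slices)
  also have "\<dots> = g (slL f (El a b) \<cdot> c)"
    using g by (simp add: counit_S1 flip: slL_apply)
  also have "\<dots> = br (El a b) f (\<lambda>q. g (q \<cdot> c))"
    by (rule slL_apply[OF El_in f lin_mu(1)[OF g]])
  also have "\<dots> = f (slR g (El a (b \<cdot> c)))"
    using f g by (simp add: El_module slR_apply)
  finally show "f (slR g (El a (b \<cdot> c))) = f (slR eps (El a (slR g (S1 b c))))" by simp
qed

text \<open>Biopposite reading: (cb (x) a)E = c b_1 (x) a Q(b_2), where Q is the barred
  Pi^L.\<close>

lemmas slL_Er_mult = weak_bialgebra.slR_El_mult[OF biopposite, unfolded sl1_flip sl2_flip]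

text \<open>The preceding identity as an equation of tensors, with \<open>slR eps (El a p)\<close>
  as P(p)a. It is needed for evaluating E(a (x) bc) on forms that are not products.\<close>

lemma El_mult_eq_map:
  "El a (b \<cdot> c) = map_tens (\<lambda>p. slR eps (El a p)) (\<lambda>q. q) (S1 b c)"
proof (rule prod_forms_suffice)
  have lin: "lfun (\<lambda>p. f (slR eps (El a p)))" if "lfun f" for f
    using that by (simp add: slR_apply lin_El)
  then show "map_tens (\<lambda>p. slR eps (El a p)) (\<lambda>q. q) (S1 b c) \<in> tensors" by simp
  fix f g assume f: "lfun f" and g: "lfun g"
  have "br (El a (b \<cdot> c)) f g = f (slR eps (El a (slR g (S1 b c))))"
    using slR_El_mult[OF g, of a b c] slR_apply[OF El_in f g] by metis
  also have "\<dots> = br (S1 b c) (\<lambda>p. f (slR eps (El a p))) g"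
    by (rule slR_apply[OF S1_in lin[OF f] g])
  finally show "br (El a (b \<cdot> c)) f g = br (map_tens (\<lambda>p. slR eps (El a p)) (\<lambda>q. q) (S1 b c)) f g"
    using f g by (simp add: br_map_tens)
qed simp

text \<open>Multiplying E(a (x) cd) = P(c_1)a (x) c_2 d by b from the left in the second leg and
  cancelling d gives P(c_1)a (x) b c_2. The legs c_1 (x) b c_2 are T3(c (x) b), and eps is applied
  to the second.\<close>

lemma slR_eps_El:
  "slR (\<lambda>x. eps (b \<cdot> x)) (El a c) = slR eps (El a (slR eps (S3 c b)))"
proof (rule separate)
  fix f assume f: "lfun f"
  define \<psi> where "\<psi> p = f (slR eps (El a p))" for p
  have \<psi>: "lfun \<psi>"
    unfolding \<psi>_def using f by (simp add: slR_apply lin_El)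
  have "b \<cdot> slL f (El a c) = slL \<psi> (S3 c b)"
  proof (rule cancel_right)
    fix g d assume g: "lfun g"
    have "g (b \<cdot> slL f (El a c) \<cdot> d) = br (El a c) f (\<lambda>q. g (b \<cdot> (q \<cdot> d)))"
      unfolding assoc by (rule slL_apply[OF El_in f lin_mu_mu(1)[OF g]])
    also have "\<dots> = f (slR (\<lambda>q. g (b \<cdot> q)) (El a (c \<cdot> d)))"
      using f g by (simp add: slR_apply El_module)
    also have "\<dots> = \<psi> (slR (\<lambda>q. g (b \<cdot> q)) (S1 c d))"
      unfolding \<psi>_def using g by (simp add: slR_El_mult)
    also have "\<dots> = br (S3 c b) \<psi> (\<lambda>q. g (q \<cdot> d))"
      using \<psi> g by (simp add: slR_apply S1_S3)
    also have "\<dots> = g (slL \<psi> (S3 c b) \<cdot> d)"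
      by (rule slL_apply[OF S3_in \<psi> lin_mu(1)[OF g], symmetric])
    finally show "g (b \<cdot> slL f (El a c) \<cdot> d) = g (slL \<psi> (S3 c b) \<cdot> d)" .
  qed
  then have "eps (b \<cdot> slL f (El a c)) = \<psi> (slR eps (S3 c b))"
    using \<psi> by (simp add: slL_apply slR_apply)
  moreover have "eps (b \<cdot> slL f (El a c)) = f (slR (\<lambda>x. eps (b \<cdot> x)) (El a c))"
    using slL_apply[OF El_in f lin_mu(2)[OF lin_eps]] f by (simp add: slR_apply)
  ultimately show "f (slR (\<lambda>x. eps (b \<cdot> x)) (El a c)) = f (slR eps (El a (slR eps (S3 c b))))"
    by (simp add: \<psi>_def)
qed

lemmas slR_eps_Er = weak_bialgebra.slR_eps_El[OF opposite]

text \<open>The counterpart of axiom (vi) for \<open>id \<otimes> \<epsilon>\<close>: the two actions defining the barred \<open>\<Pi>\<^sup>R\<close> form a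
  multiplier as soon as those defining the barred \<open>\<Pi>\<^sup>L\<close> do.\<close>

lemma slR_multiplier:
  assumes slL_mult: "\<And>a b c. slL eps (Er a b) \<cdot> c = b \<cdot> slL eps (S2 a c)"
  shows "c \<cdot> slR eps (El b a) = slR eps (S1 c a) \<cdot> b"
proof (rule cancel_left)
  fix f v assume f: "lfun f"
  define fb where "fb = (\<lambda>x. f (x \<cdot> b))"
  define fvc where "fvc = (\<lambda>x. f (v \<cdot> (c \<cdot> x)))"
  have fb: "lfun fb" and fvc: "lfun fvc" using f by (simp_all add: fb_def fvc_def)
  \<comment> \<open>Let y be the inner slice of T2(v (x) c). \<open>slL_Er_mult\<close> expresses
    the slice of (vc (x) d)E through the barred Pi^L of y, to which the hypothesis applies.\<close>
  have "slL fvc (El b a) = slL eps (S2 (slL fb (S2 v c)) a)"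
  proof (rule cancel_left)
    fix \<phi> d assume \<phi>: "lfun \<phi>"
    have "\<phi> (d \<cdot> slL fvc (El b a)) = br (El b a) (\<lambda>x. f (v \<cdot> c \<cdot> x)) (\<lambda>x. \<phi> (d \<cdot> x))"
      unfolding assoc fvc_def[symmetric] by (rule slL_apply[OF El_in fvc lin_mu(2)[OF \<phi>]])
    also have "\<dots> = br (Er (v \<cdot> c) d) fb (\<lambda>x. \<phi> (x \<cdot> a))"
      unfolding fb_def by (rule E_mult[OF f \<phi>])
    also have "\<dots> = \<phi> (slL fb (Er (v \<cdot> c) d) \<cdot> a)"
      by (rule slL_apply[OF Er_in fb lin_mu(1)[OF \<phi>], symmetric])
    also have "\<dots> = \<phi> (d \<cdot> slL eps (S2 (slL fb (S2 v c)) a))"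
      using fb by (simp add: slL_Er_mult slL_mult)
    finally show "\<phi> (d \<cdot> slL fvc (El b a)) = \<phi> (d \<cdot> slL eps (S2 (slL fb (S2 v c)) a))" .
  qed
  then have "br (El b a) fvc eps = br (S2 (slL fb (S2 v c)) a) eps eps"
    using slL_apply[OF El_in fvc lin_eps, of b a] slL_apply[OF S2_in lin_eps lin_eps, of "slL fb (S2 v c)" a]
    by metis
  \<comment> \<open>Under eps (x) eps the counit reduces T2(y (x) a) to eps(ya), which removes the
    barred Pi^L altogether.\<close>
  also have "\<dots> = eps (slL fb (S2 v c) \<cdot> a)"
    by (simp flip: slR_apply add: counit_S2)
  also have "\<dots> = br (S2 v c) fb (\<lambda>x. eps (x \<cdot> a))"
    by (rule slL_apply[OF S2_in fb lin_mu(1)[OF lin_eps]])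
  also have "\<dots> = br (S1 c a) (\<lambda>x. f (v \<cdot> (x \<cdot> b))) eps"
    using fb by (simp add: S2_S1 fb_def assoc)
  also have "\<dots> = f (v \<cdot> (slR eps (S1 c a) \<cdot> b))"
    by (rule slR_apply[OF S1_in lin_mu_mu(1)[OF f] lin_eps, symmetric])
  finally show "f (v \<cdot> (c \<cdot> slR eps (El b a))) = f (v \<cdot> (slR eps (S1 c a) \<cdot> b))"
    using slR_apply[OF El_in fvc lin_eps] by (simp add: fvc_def)
qed

text \<open>By \<open>S1_S3\<close>, a functional killing the first legs of T1 kills those of T3
  after a right multiplication in the second leg, which is then cancelled. In terms of spans:
  T3-slices lie in the span of T1-slices.\<close>

lemma vanish_S1_imp_S3:
  assumes f: "lfun f" and 0: "\<And>a b g. lfun g \<Longrightarrow> br (S1 a b) f g = 0" and g: "lfun g"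
  shows "br (S3 a b) f g = 0"
proof -
  have "br (S3 a b) f g = br 0 f g"
  proof (rule br_cancel_2r)
    show "br (S3 a b) f (\<lambda>p. g (p \<cdot> u)) = br 0 f (\<lambda>p. g (p \<cdot> u))" if "lfun g" for g u
      using that f 0 by (simp add: br_def[of 0] flip: S1_S3)
  qed (simp_all only: S3_in zero_in f g)
  then show ?thesis by (simp add: br_def[of 0])
qed

lemma vanish_eps_imp_S1:
  assumes mult: "\<And>a b c. c \<cdot> slR eps (El b a) = slR eps (S1 c a) \<cdot> b"
    and f: "lfun f" and 0: "\<And>a b. br (S1 a b) f eps = 0" and g: "lfun g"
  shows "br (S1 a b) f g = 0"
proof -
  have "br (S1 a (b \<cdot> c)) f g = 0" for b c
  proof -
    \<comment> \<open>The multiplier hypothesis identifies \<open>m p q\<close> with (id (x) g)(T1(a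
      (x) q)) P(p). Its sum over p (x) q in T1(b (x) c) is to be the slice of T1(a (x) bc).\<close>
    define m where "m p q = slR eps (S1 (slR g (S1 a q)) p)" for p q
    have m: "bl (\<lambda>p q. \<phi> (m p q))" if \<phi>: "lfun \<phi>" for \<phi>
    proof (rule bilinI)
      show "lfun (\<lambda>p. \<phi> (m p q))" for q
        unfolding m_def using \<phi> by (simp add: slR_apply lin_S1)
      have "lfun (\<lambda>q. br (S1 a q) (\<lambda>y. br (S1 y p) \<phi> eps) g)" for p
        using \<phi> g by (simp add: lin_S1)
      moreover have "\<phi> (m p q) = br (S1 a q) (\<lambda>y. br (S1 y p) \<phi> eps) g" for p q
        unfolding m_def using \<phi> g slR_apply[OF S1_in lin_S1(1)[OF \<phi> lin_eps] g]
        by (simp add: slR_apply)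
      ultimately show "lfun (\<lambda>q. \<phi> (m p q))" for p by simp
    qed
    obtain d where d: "\<forall>\<phi>. lfun \<phi> \<longrightarrow> \<phi> d = S1 b c (\<lambda>p q. \<phi> (m p q))"
      using tensors_lin_form[of "S1 b c" m, OF S1_in m] by blast
    have "slR g (S1 a (b \<cdot> c)) = d"
    proof (rule cancel_right)
      fix \<phi> u assume \<phi>: "lfun \<phi>"
      have Dl: "br (Dl a z q) \<phi> g = \<phi> (slR g (S1 a q) \<cdot> z)" for z q
        unfolding S1_right[OF \<phi> g, symmetric]
        by (rule slR_apply[OF S1_in lin_mu(1)[OF \<phi>] g, symmetric])
      have bl: "bl (\<lambda>r s. br (Dl a r s) \<phi> g)"
        using \<phi> g by (auto intro!: bilinI simp: lin_Dl)
      \<comment> \<open>Inserts E by Delta(a)E = Delta(a), so that \<open>El_mult_eq_map\<close>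
        becomes applicable.\<close>
      have "\<phi> (slR g (S1 a (b \<cdot> c)) \<cdot> u) = El u (b \<cdot> c) (\<lambda>r s. br (Dl a r s) \<phi> g)"
        using Dl_E[OF \<phi> g, of u "b \<cdot> c" a] Dl[of u "b \<cdot> c"] by simp
      also have "\<dots> = S1 b c (\<lambda>p q. \<phi> (m p q \<cdot> u))"
        unfolding El_mult_eq_map map_tens_def using bl by (simp add: Dl mult m_def)
      also have "\<dots> = \<phi> (d \<cdot> u)"
        using d[rule_format, OF lin_mu(1)[OF \<phi>]] by simp
      finally show "\<phi> (slR g (S1 a (b \<cdot> c)) \<cdot> u) = \<phi> (d \<cdot> u)" .
    qed
    \<comment> \<open>Each \<open>m p q\<close> is itself an eps-slice of T1.\<close>
    moreover have "f (m p q) = 0" for p q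
      unfolding m_def using f 0 by (simp add: slR_apply)
    ultimately show ?thesis
      using d[rule_format, OF f] f g by (simp flip: slR_apply)
  qed
  then show ?thesis
    by (rule idem[OF lin_S1(2)[OF f g]])
qed

text \<open>T2(a (x) b)E = T2(a (x) b): a left factor v in the second leg turns T2(a (x) b) into (a
  (x) v)Delta(b), which absorbs E, and v is then cancelled.\<close>

lemma S2_E:
  assumes f: "lfun f" and g: "lfun g"
  shows "S2 a b (\<lambda>p q. br (Er p q) f g) = br (S2 a b) f g"
proof -
  have Er_module: "br (Er p (v \<cdot> q)) f g = br (Er p q) f (\<lambda>x. g (v \<cdot> x))" if "lfun g" for p v q g
    using weak_bialgebra.axioms(1)[OF opposite, THEN weak_bialgebra_data.El_module(2), OF f that] .
  have bl: "bl (\<lambda>p q. br (Er p q) f g)" if "lfun g" for g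
    using that f by (auto intro!: bilinI simp: lin_Er)
  have Dr: "Dr b a v = map_tens (\<lambda>p. p) (\<lambda>q. v \<cdot> q) (S2 a b)" for v
    by (rule prod_forms_suffice) (simp_all add: br_map_tens S2_left)
  obtain d where d: "\<forall>\<phi>. lfun \<phi> \<longrightarrow> \<phi> d = S2 a b (\<lambda>p q. \<phi> (slL f (Er p q)))"
    using tensors_lin_form[OF S2_in, of "\<lambda>p q. slL f (Er p q)" a b] f bl by (auto simp: slL_apply)
  have d: "\<phi> d = S2 a b (\<lambda>p q. br (Er p q) f \<phi>)" if "lfun \<phi>" for \<phi>
    using d that f by (simp add: slL_apply)
  have "d = slL f (S2 a b)"
  proof (rule cancel_left)
    fix \<phi> v assume \<phi>: "lfun \<phi>"
    have "\<phi> (v \<cdot> d) = S2 a b (\<lambda>p q. br (Er p q) f (\<lambda>x. \<phi> (v \<cdot> x)))"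
      by (rule d[OF lin_mu(2)[OF \<phi>]])
    also have "\<dots> = Dr b a v (\<lambda>p q. br (Er p q) f \<phi>)"
      unfolding Dr map_tens_def using bl[OF \<phi>] Er_module[OF \<phi>] by simp
    also have "\<dots> = br (S2 a b) f (\<lambda>x. \<phi> (v \<cdot> x))"
      using f \<phi> by (simp add: Dr_E S2_left)
    also have "\<dots> = \<phi> (v \<cdot> slL f (S2 a b))"
      by (rule slL_apply[OF S2_in f lin_mu(2)[OF \<phi>], symmetric])
    finally show "\<phi> (v \<cdot> d) = \<phi> (v \<cdot> slL f (S2 a b))" .
  qed
  then show ?thesis using d[OF g] f g by (simp add: slL_apply)
qed

text \<open>By the counit, ab = (id (x) eps)(T2(a (x) b)E) is a sum of terms p Pi^R(q), so a
  functional killing these kills all products.\<close>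

lemma vanish_Er_imp_zero:
  assumes f: "lfun f" and "\<And>p q. br (Er p q) f eps = 0"
  shows "f x = 0"
proof (rule idem[OF f])
  fix a b
  have "f (a \<cdot> b) = S2 a b (\<lambda>p q. br (Er p q) f eps)"
    using f by (simp add: S2_E slR_apply flip: counit_S2)
  then show "f (a \<cdot> b) = 0" using assms by simp
qed

text \<open>\<open>\<Pi>\<^sup>R(w)\<close> equals the barred \<open>\<Pi>\<^sup>R(z)\<close>.\<close>

definition sqR_eq :: "'a \<Rightarrow> 'a \<Rightarrow> bool" where
  "sqR_eq w z \<longleftrightarrow> (\<forall>b. slR eps (S3 b w) = slR eps (El b z) \<and> slR eps (Er b w) = slR eps (S1 b z))"

lemma sqR_eq_iff:
  "sqR_eq w z \<longleftrightarrow> (\<forall>b f. lfun f \<longrightarrow>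
    br (S3 b w) f eps = br (El b z) f eps \<and> br (Er b w) f eps = br (S1 b z) f eps)"
proof
  show "\<forall>b f. lfun f \<longrightarrow> br (S3 b w) f eps = br (El b z) f eps \<and> br (Er b w) f eps = br (S1 b z) f eps"
    if "sqR_eq w z"
    using that unfolding sqR_eq_def by (simp flip: slR_apply)
  show "sqR_eq w z"
    if "\<forall>b f. lfun f \<longrightarrow> br (S3 b w) f eps = br (El b z) f eps \<and> br (Er b w) f eps = br (S1 b z) f eps"
    unfolding sqR_eq_def by (intro allI conjI; rule separate) (use that in \<open>simp_all add: slR_apply\<close>)
qed

text \<open>The related pairs form a subspace of A x A, which permits span induction from the slices
  of T1 and T3.\<close>

lemma sqR_eq_linear:
  assumes "sqR_eq w z" "sqR_eq w' z'"
  shows "sqR_eq (scale c w + w') (scale c z + z')"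
proof -
  have "lfun (\<lambda>w. br (S3 b w) f eps)" "lfun (\<lambda>w. br (El b w) f eps)"
    "lfun (\<lambda>w. br (Er b w) f eps)" "lfun (\<lambda>w. br (S1 b w) f eps)" if "lfun f" for b f
    using that weak_bialgebra_data.lin_S1(2)[OF op that lin_eps] by (simp_all add: lin_El lin_Er lin_S1)
  then show ?thesis
    using assms unfolding sqR_eq_iff by (simp add: lin_iff)
qed

lemma sqR_eq_0: "sqR_eq 0 0"
  using weak_bialgebra_data.lin_S1(2)[OF op _ lin_eps]
  unfolding sqR_eq_iff by (simp add: lin_El lin_Er lin_S1 lin_zero[of "\<lambda>w. br (_ w) _ _"])

text \<open>Both multipliers are \<open>1\<^sub>1\<epsilon>(b1\<^sub>2c)\<close>.\<close>

lemma sqR_eq_slices: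
  assumes mult1: "\<And>a b c. c \<cdot> slR eps (El b a) = slR eps (S1 c a) \<cdot> b"
    and mult3: "\<And>a b c. slR eps (Er b a) \<cdot> c = b \<cdot> slR eps (S3 c a)"
  shows "sqR_eq (slR eps (S1 b c)) (slR eps (S3 c b))"
proof -
  let ?w = "slR eps (S1 b c)" and ?z = "slR eps (S3 c b)"
  \<comment> \<open>The common value is (id (x) eps)((x (x) b)E(a (x) c)). It mixes a left with a
    right action; the multiplier hypotheses and cancellation then separate the two.\<close>
  have *: "x \<cdot> slR eps (El a ?z) = slR eps (Er x ?w) \<cdot> a" for x a
  proof (rule separate)
    fix f assume f: "lfun f"
    have "f (x \<cdot> slR eps (El a ?z)) = br (El a c) (\<lambda>p. f (x \<cdot> p)) (\<lambda>q. eps (b \<cdot> q))"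
      unfolding slR_eps_El[symmetric] by (rule slR_apply[OF El_in lin_mu(2)[OF f] lin_mu(2)[OF lin_eps]])
    also have "\<dots> = br (Er x b) (\<lambda>p. f (p \<cdot> a)) (\<lambda>q. eps (q \<cdot> c))"
      by (rule E_mult[OF f lin_eps])
    also have "\<dots> = f (slR eps (Er x ?w) \<cdot> a)"
      unfolding slR_eps_Er[symmetric]
      by (rule slR_apply[OF Er_in lin_mu(1)[OF f] lin_mu(1)[OF lin_eps], symmetric])
    finally show "f (x \<cdot> slR eps (El a ?z)) = f (slR eps (Er x ?w) \<cdot> a)" .
  qed
  show ?thesis
    unfolding sqR_eq_def
  proof (intro allI conjI)
    fix a
    show "slR eps (S3 a ?w) = slR eps (El a ?z)"
      by (rule cancel_left) (simp add: * mult3)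
    show "slR eps (Er a ?w) = slR eps (S1 a ?z)"
      by (rule cancel_right) (simp add: mult1 flip: *)
  qed
qed

lemma sqR_equivalences:
  assumes mult1: "\<And>a b c. c \<cdot> slR eps (El b a) = slR eps (S1 c a) \<cdot> b"
    and mult3: "\<And>a b c. slR eps (Er b a) \<cdot> c = b \<cdot> slR eps (S3 c a)"
  defines "c1 \<equiv> span {slR w (S1 a b) | a b w. lfun w} = UNIV"
    and "c2 \<equiv> span {slR w (S3 a b) | a b w. lfun w} = UNIV"
    and "c3 \<equiv> span {slR eps (S1 a b) | a b. True} = UNIV"
    and "c4 \<equiv> span {slR eps (S3 a b) | a b. True} = UNIV"
    and "c5 \<equiv> range (\<lambda>w. (\<lambda>b. slR eps (S3 b w), \<lambda>b. slR eps (Er b w))) =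
      range (\<lambda>z. (\<lambda>b. slR eps (El b z), \<lambda>b. slR eps (S1 b z)))"
  shows "(c1 \<longleftrightarrow> c2) \<and> (c1 \<longleftrightarrow> c3) \<and> (c1 \<longleftrightarrow> c4) \<and> (c1 \<longleftrightarrow> c5)"
proof -
  have slices: "span {slR w (X a b) | a b w. P w} = UNIV \<longleftrightarrow>
      (\<forall>f. lfun f \<longrightarrow> (\<forall>a b w. P w \<longrightarrow> br (X a b) f w = 0) \<longrightarrow> (\<forall>x. f x = 0))"
    if "\<And>a b. X a b \<in> tensors" "\<And>w. P w \<Longrightarrow> lfun w" for X :: "'a \<Rightarrow> 'a \<Rightarrow> ('k,'a) ten" and P
  proof -
    have ball: "(\<forall>x\<in>{slR w (X a b) | a b w. P w}. f x = 0) \<longleftrightarrow> (\<forall>a b w. P w \<longrightarrow> f (slR w (X a b)) = 0)" for f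
      by blast
    have "f (slR w (X a b)) = br (X a b) f w" if "lfun f" "P w" for f w a b
      by (rule slR_apply) (fact that(1) | rule \<open>\<And>a b. X a b \<in> tensors\<close> \<open>\<And>w. P w \<Longrightarrow> lfun w\<close>[OF that(2)])+
    then show ?thesis unfolding span_eq_UNIV_iff ball by (simp cong: imp_cong)
  qed
  have c1: "c1 \<longleftrightarrow> (\<forall>f. lfun f \<longrightarrow> (\<forall>a b w. lfun w \<longrightarrow> br (S1 a b) f w = 0) \<longrightarrow> (\<forall>x. f x = 0))"
    and c2: "c2 \<longleftrightarrow> (\<forall>f. lfun f \<longrightarrow> (\<forall>a b w. lfun w \<longrightarrow> br (S3 a b) f w = 0) \<longrightarrow> (\<forall>x. f x = 0))"
    unfolding c1_def c2_def by (auto intro!: slices)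
  have c3: "c3 \<longleftrightarrow> (\<forall>f. lfun f \<longrightarrow> (\<forall>a b. br (S1 a b) f eps = 0) \<longrightarrow> (\<forall>x. f x = 0))"
    and c4: "c4 \<longleftrightarrow> (\<forall>f. lfun f \<longrightarrow> (\<forall>a b. br (S3 a b) f eps = 0) \<longrightarrow> (\<forall>x. f x = 0))"
    using slices[of S1 "\<lambda>w. w = eps"] slices[of S3 "\<lambda>w. w = eps"] unfolding c3_def c4_def by simp_all
  have "(\<lambda>b. slR eps (S3 b w), \<lambda>b. slR eps (Er b w)) = (\<lambda>b. slR eps (El b z), \<lambda>b. slR eps (S1 b z))
      \<longleftrightarrow> sqR_eq w z" for w z
    by (auto simp: sqR_eq_def fun_eq_iff)
  moreover have "range F = range G \<longleftrightarrow> (\<forall>w. \<exists>z. F w = G z) \<and> (\<forall>z. \<exists>w. F w = G z)"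
    for F G :: "'a \<Rightarrow> ('a \<Rightarrow> 'a) \<times> ('a \<Rightarrow> 'a)"
    unfolding set_eq_subset image_subset_iff image_iff by (simp, metis)
  ultimately have c5: "c5 \<longleftrightarrow> (\<forall>w. \<exists>z. sqR_eq w z) \<and> (\<forall>z. \<exists>w. sqR_eq w z)"
    unfolding c5_def by simp
  note op_vanish_S1_imp_S3 = weak_bialgebra.vanish_S1_imp_S3[OF opposite]
  note op_vanish_eps_imp_S1 = weak_bialgebra.vanish_eps_imp_S1[OF opposite, OF mult3]
  note op_vanish_Er_imp_zero = weak_bialgebra.vanish_Er_imp_zero[OF opposite]
  have 12: "c1 \<longleftrightarrow> c2"
    unfolding c1 c2 using vanish_S1_imp_S3 op_vanish_S1_imp_S3 by blast
  have 13: "c1 \<longleftrightarrow> c3"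
    unfolding c1 c3 using vanish_eps_imp_S1[OF mult1] lin_eps by blast
  have 24: "c2 \<longleftrightarrow> c4"
    unfolding c2 c4 using op_vanish_eps_imp_S1 lin_eps by blast
  have sqR_span: "\<exists>w. sqR_eq w z" if "z \<in> span {slR eps (S3 a b) | a b. True}" for z
    using that
  proof (induction rule: span_induct_alt)
    case (step c x y)
    then show ?case
      using sqR_eq_slices[OF mult1 mult3] sqR_eq_linear by blast
  qed (use sqR_eq_0 in blast)
  have sqRbar_span: "\<exists>z. sqR_eq w z" if "w \<in> span {slR eps (S1 a b) | a b. True}" for w
    using that
  proof (induction rule: span_induct_alt)
    case (step c x y)
    then show ?case
      using sqR_eq_slices[OF mult1 mult3] sqR_eq_linear by blast
  qed (use sqR_eq_0 in blast)
  have 345: "c5" if c3 c4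
    using that sqR_span sqRbar_span unfolding c5 c3_def c4_def by blast
  \<comment> \<open>Under \<open>c5\<close>, each p Pi^R(q) equals p P(z) for some z, which is an
    eps-slice of T1.\<close>
  have 53: "c3" if c5
    unfolding c3
  proof (intro allI impI)
    fix f x assume f: "lfun f" and 0: "\<forall>a b. br (S1 a b) f eps = 0"
    have "br (Er p q) f eps = 0" for p q
      using \<open>c5\<close> 0 f unfolding c5 sqR_eq_iff by metis
    then show "f x = 0" by (rule vanish_Er_imp_zero[OF f])
  qed
  \<comment> \<open>\<open>c3\<close> and \<open>c4\<close> are already equivalent through
    \<open>c1\<close> and \<open>c2\<close>, so either one supplies both premises of
    \<open>345\<close>.\<close>
  show ?thesis using 12 13 24 345 53 by blast
qed

end

section \<open>Regular weak multiplier bialgebras\<close>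

locale regular_weak_multiplier_bialgebra = tensor_square sc
  for sc :: "'k::field \<Rightarrow> 'a::ab_group_add \<Rightarrow> 'a" +
  fixes mu :: "'a \<Rightarrow> 'a \<Rightarrow> 'a" (infixl "\<cdot>" 70)
    and E :: "('k,'a) mlt" and De :: "'a \<Rightarrow> ('k,'a) mlt" and eps :: "'a \<Rightarrow> 'k"
  assumes regular: "regular_wmba sc mu E De eps"
begin

abbreviation tn :: "'a \<Rightarrow> 'a \<Rightarrow> ('k,'a) ten" where "tn \<equiv> tens sc"

sublocale nondeg_algebra sc mu
proof
  have lin1: "Vector_Spaces.linear sc sc (mu u)" for u
    using regular unfolding regular_wmba_def by (elim conjE) (erule spec)
  have lin2: "Vector_Spaces.linear sc sc (\<lambda>x. x \<cdot> u)" for u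
    using regular unfolding regular_wmba_def by (elim conjE) (erule spec)
  show "lfun (\<lambda>x. f (x \<cdot> u))" if "lfun f" for f u
    using that lin2[of u] by (simp add: lin_iff Vector_Spaces.linear_iff)
  show "lfun (\<lambda>x. f (u \<cdot> x))" if "lfun f" for f u
    using that lin1[of u] by (simp add: lin_iff Vector_Spaces.linear_iff)
  have "\<forall>a b c. (a \<cdot> b) \<cdot> c = a \<cdot> (b \<cdot> c)"
    using regular unfolding regular_wmba_def by (elim conjE)
  then show "(x \<cdot> y) \<cdot> z = x \<cdot> (y \<cdot> z)" for x y z
    by blast
  show "f z = 0" if "lfun f" "\<And>x y. f (x \<cdot> y) = 0" for f z
  proof -
    have "span {x \<cdot> y | x y. True} = UNIV"
      using regular unfolding regular_wmba_def by (elim conjE)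
    then show ?thesis
      using that unfolding span_eq_UNIV_iff by blast
  qed
  have "\<forall>b. (\<forall>a. a \<cdot> b = 0) \<longrightarrow> b = 0"
    using regular unfolding regular_wmba_def by (elim conjE)
  then show "x = 0" if "\<And>u. u \<cdot> x = 0" for x
    using that by blast
  have "\<forall>b. (\<forall>a. b \<cdot> a = 0) \<longrightarrow> b = 0"
    using regular unfolding regular_wmba_def by (elim conjE)
  then show "x = 0" if "\<And>u. x \<cdot> u = 0" for x
    using that by blast
qed

section \<open>Deriving the slice data from the axioms\<close>

lemma E_is_mult: "is_mult sc mu E"
  using regular unfolding regular_wmba_def by (elim conjE)

lemma De_is_mult: "is_mult sc mu (De x)"
  using regular unfolding regular_wmba_def by (elim conjE) (erule spec)

lemmas E_endo = is_mult_endo[OF E_is_mult]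
lemmas De_endo = is_mult_endo[OF De_is_mult]

lemma E_idem:
  assumes "x \<in> tensors"
  shows "fst E (fst E x) = fst E x" and "snd E (snd E x) = snd E x"
proof -
  have "meq sc (mprod E E) E"
    using regular unfolding regular_wmba_def by (elim conjE)
  then show "fst E (fst E x) = fst E x" "snd E (snd E x) = snd E x"
    using assms by (simp_all add: meq_def mprod_def)
qed

lemma lin_De:
  assumes z: "z \<in> tensors"
  shows "lfun (\<lambda>x. fst (De x) z B)" and "lfun (\<lambda>x. snd (De x) z B)"
proof -
  have "\<forall>a b. meq sc (De (a + b)) ((\<lambda>y. fst (De a) y + fst (De b) y), (\<lambda>y. snd (De a) y + snd (De b) y))"
    using regular unfolding regular_wmba_def by (elim conjE)
  moreover have "\<forall>c a. meq sc (De (sc c a)) ((\<lambda>y. tsc c (fst (De a) y)), (\<lambda>y. tsc c (snd (De a) y)))"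
    using regular unfolding regular_wmba_def by (elim conjE)
  ultimately show "lfun (\<lambda>x. fst (De x) z B)" "lfun (\<lambda>x. snd (De x) z B)"
    using z by (simp_all add: lin_iff meq_def tsc_def)
qed

text \<open>Axiom (iv) places Delta(x)(a (x) b) in the image of the idempotent E, and similarly on
  the right.\<close>

lemma E_De:
  shows "fst E (fst (De x) (tn a b)) = fst (De x) (tn a b)" and "snd E (snd (De x) (tn a b)) = snd (De x) (tn a b)"
proof -
  interpret t: vector_space "tsc :: 'k \<Rightarrow> (('a \<Rightarrow> 'a \<Rightarrow> 'k) \<Rightarrow> 'k) \<Rightarrow> _" by (rule tsc_vector_space)
  have "t.span {fst (De a) (tn b b') | a b b'. True} = t.span {fst E (tn b b') | b b'. True}"
    using regular unfolding regular_wmba_def by (elim conjE)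
  moreover have "t.span {snd (De a) (tn b b') | a b b'. True} = t.span {snd E (tn b b') | b b'. True}"
    using regular unfolding regular_wmba_def by (elim conjE)
  moreover have "fst (De x) (tn a b) \<in> t.span {fst (De a) (tn b b') | a b b'. True}"
    and "snd (De x) (tn a b) \<in> t.span {snd (De a) (tn b b') | a b b'. True}"
    by (rule t.span_base; blast)+
  ultimately have "fst (De x) (tn a b) \<in> t.span {fst E (tn b b') | b b'. True}"
    and "snd (De x) (tn a b) \<in> t.span {snd E (tn b b') | b b'. True}"
    by simp_all
  then show "fst E (fst (De x) (tn a b)) = fst (De x) (tn a b)" "snd E (snd (De x) (tn a b)) = snd (De x) (tn a b)"
    using endo_fixes_span[OF E_endo(1) E_idem(1)] endo_fixes_span[OF E_endo(2) E_idem(2)] by blast+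
qed

text \<open>Multiplying by u (x) v from the other side moves both multipliers across, where
  \<open>E_De\<close> applies.\<close>

lemma De_E:
  shows "fst (De x) (fst E (tn a b)) = fst (De x) (tn a b)" and "snd (De x) (snd E (tn a b)) = snd (De x) (tn a b)"
proof -
  note [simp] = E_endo De_endo
  show "fst (De x) (fst E (tn a b)) = fst (De x) (tn a b)"
    by (rule tmult_cancel_left) (simp_all add: is_mult_tmult[OF De_is_mult] is_mult_tmult[OF E_is_mult] E_De)
  show "snd (De x) (snd E (tn a b)) = snd (De x) (tn a b)"
    by (rule tmult_cancel_right)
      (simp_all add: is_mult_tmult[OF De_is_mult, symmetric] is_mult_tmult[OF E_is_mult, symmetric] E_De)
qed

lemma T_mis:
  shows "mis sc mu (mprod (De a) (one_t sc mu b)) (T1 sc mu De a b)"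
    and "mis sc mu (mprod (t_one sc mu a) (De b)) (T2 sc mu De a b)"
    and "mis sc mu (mprod (one_t sc mu b) (De a)) (T3 sc mu De a b)"
    and "mis sc mu (mprod (De b) (t_one sc mu a)) (T4 sc mu De a b)"
proof -
  have "\<forall>a b. \<exists>x. mis sc mu (mprod (De a) (one_t sc mu b)) x"
    using regular unfolding regular_wmba_def by (elim conjE)
  then show "mis sc mu (mprod (De a) (one_t sc mu b)) (T1 sc mu De a b)"
    unfolding T1_def by (intro mis_The) blast
  have "\<forall>a b. \<exists>x. mis sc mu (mprod (t_one sc mu a) (De b)) x"
    using regular unfolding regular_wmba_def by (elim conjE)
  then show "mis sc mu (mprod (t_one sc mu a) (De b)) (T2 sc mu De a b)"
    unfolding T2_def by (intro mis_The) blast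
  have "\<forall>a b. \<exists>x. mis sc mu (mprod (one_t sc mu b) (De a)) x"
    using regular unfolding regular_wmba_def by (elim conjE)
  then show "mis sc mu (mprod (one_t sc mu b) (De a)) (T3 sc mu De a b)"
    unfolding T3_def by (intro mis_The) blast
  have "\<forall>a b. \<exists>x. mis sc mu (mprod (De b) (t_one sc mu a)) x"
    using regular unfolding regular_wmba_def by (elim conjE)
  then show "mis sc mu (mprod (De b) (t_one sc mu a)) (T4 sc mu De a b)"
    unfolding T4_def by (intro mis_The) blast
qed

lemma E3:
  obtains E3 where
    "is_ext sc mu (id_De sc mu De) (one_E sc E) E E3" "is_ext sc mu (De_id sc mu De) (E_one sc E) E E3"
    "meq3 sc (mprod (E_one sc E) (one_E sc E)) E3" "meq3 sc E3 (mprod (one_E sc E) (E_one sc E))"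
  using regular unfolding regular_wmba_def by (elim conjE exE)

lemma E3_identities:
  assumes f: "lfun f" and g: "lfun g" and h: "lfun h"
  shows "br (fst (De b) (tn v w)) (\<lambda>s. br (fst E (tn (a \<cdot> u) s)) f g) h =
      br (fst E (tn a b)) (\<lambda>p. f (p \<cdot> u)) (\<lambda>q. br (fst (De q) (tn v w)) g h)"
    and "br (snd (De b) (tn v w)) (\<lambda>s. br (snd E (tn (u \<cdot> a) s)) f g) h =
      br (snd E (tn a b)) (\<lambda>p. f (u \<cdot> p)) (\<lambda>q. br (snd (De q) (tn v w)) g h)"
    and "br (fst (De b) (tn w v)) h (\<lambda>s. br (fst E (tn s (a \<cdot> u))) g f) =
      br (fst E (tn b a)) (\<lambda>q. br (fst (De q) (tn w v)) h g) (\<lambda>p. f (p \<cdot> u))"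
    and "br (snd (De b) (tn w v)) h (\<lambda>s. br (snd E (tn s (u \<cdot> a))) g f) =
      br (snd E (tn b a)) (\<lambda>q. br (snd (De q) (tn w v)) h g) (\<lambda>p. f (u \<cdot> p))"
proof -
  obtain E3 where
    ext1: "is_ext sc mu (id_De sc mu De) (one_E sc E) E E3" and
    ext2: "is_ext sc mu (De_id sc mu De) (E_one sc E) E E3" and
    E3: "meq3 sc (mprod (E_one sc E) (one_E sc E)) E3" "meq3 sc E3 (mprod (one_E sc E) (E_one sc E))"
    by (rule E3)
  \<comment> \<open>Both orders of the factors in axiom (v) are needed: the factor on the two legs
    filled by Delta must act first, and a product of multipliers acts in opposite orders on the left
    and on the right.\<close>
  have fst_E3: "fst E3 s = fst (E_one sc E) (fst (one_E sc E) s)" "fst E3 s = fst (one_E sc E) (fst (E_one sc E) s)"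
    and snd_E3: "snd E3 s = snd (one_E sc E) (snd (E_one sc E) s)" "snd E3 s = snd (E_one sc E) (snd (one_E sc E) s)"
    if "s \<in> AAA sc" for s
    using E3 that by (simp_all add: meq3_def mprod_def)
  have ext:
    "fst E3 (fst (id_De sc mu De x) y) = fst (id_De sc mu De (fst E x)) y"
    "snd E3 (snd (id_De sc mu De x) y) = snd (id_De sc mu De (snd E x)) y"
    "fst E3 (fst (De_id sc mu De x) y) = fst (De_id sc mu De (fst E x)) y"
    "snd E3 (snd (De_id sc mu De x) y) = snd (De_id sc mu De (snd E x)) y"
    if "x \<in> tensors" "y \<in> AAA sc" for x y
    using ext1 ext2 that unfolding is_ext_def by blast+
  have id_De: "fst (id_De sc mu De x) s = (\<lambda>C. if tlf C then x (\<lambda>a b. s (\<lambda>c k l. fst (De b) (tn k l) (\<lambda>u v. C (a \<cdot> c) u v))) else 0)"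
    "snd (id_De sc mu De x) s = (\<lambda>C. if tlf C then x (\<lambda>a b. s (\<lambda>c k l. snd (De b) (tn k l) (\<lambda>u v. C (c \<cdot> a) u v))) else 0)"
    "fst (De_id sc mu De x) s = (\<lambda>C. if tlf C then x (\<lambda>a b. s (\<lambda>k l c. fst (De a) (tn k l) (\<lambda>u v. C u v (b \<cdot> c)))) else 0)"
    "snd (De_id sc mu De x) s = (\<lambda>C. if tlf C then x (\<lambda>a b. s (\<lambda>k l c. snd (De a) (tn k l) (\<lambda>u v. C u v (c \<cdot> b)))) else 0)" for x s
    by (simp_all only: id_De_def De_id_def fst_conv snd_conv)
  have E_one: "fst (E_one sc E) s = (\<lambda>C. if tlf C then s (\<lambda>a b c. fst E (tn a b) (\<lambda>x y. C x y c)) else 0)"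
    "fst (one_E sc E) s = (\<lambda>C. if tlf C then s (\<lambda>a b c. fst E (tn b c) (\<lambda>x y. C a x y)) else 0)"
    "snd (E_one sc E) s = (\<lambda>C. if tlf C then s (\<lambda>a b c. snd E (tn a b) (\<lambda>x y. C x y c)) else 0)"
    "snd (one_E sc E) s = (\<lambda>C. if tlf C then s (\<lambda>a b c. snd E (tn b c) (\<lambda>x y. C a x y)) else 0)" for s
    by (simp_all only: E_one_def one_E_def fst_conv snd_conv)
  show "br (fst (De b) (tn v w)) (\<lambda>s. br (fst E (tn (a \<cdot> u) s)) f g) h =
      br (fst E (tn a b)) (\<lambda>p. f (p \<cdot> u)) (\<lambda>q. br (fst (De q) (tn v w)) g h)"
    by (rule E3_left[where e = "fst E" and d = "\<lambda>x. fst (De x)" and M = "fst E3" and m = "mu",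
          OF E_endo(1) De_endo(1) lin_De(1) lin_mu E_De(1) fst_E3(1) E_one(1) E_one(2) id_De(1)
          ext(1)[OF tens_in tens3_in] f g h])
  show "br (snd (De b) (tn v w)) (\<lambda>s. br (snd E (tn (u \<cdot> a) s)) f g) h =
      br (snd E (tn a b)) (\<lambda>p. f (u \<cdot> p)) (\<lambda>q. br (snd (De q) (tn v w)) g h)"
    by (rule E3_left[where e = "snd E" and d = "\<lambda>x. snd (De x)" and M = "snd E3" and m = "\<lambda>a b. b \<cdot> a",
          OF E_endo(2) De_endo(2) lin_De(2) lin_mu(2,1) E_De(2) snd_E3(2) E_one(3) E_one(4) id_De(2)
          ext(2)[OF tens_in tens3_in] f g h])
  show "br (fst (De b) (tn w v)) h (\<lambda>s. br (fst E (tn s (a \<cdot> u))) g f) =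
      br (fst E (tn b a)) (\<lambda>q. br (fst (De q) (tn w v)) h g) (\<lambda>p. f (p \<cdot> u))"
    by (rule E3_right[where e = "fst E" and d = "\<lambda>x. fst (De x)" and M = "fst E3" and m = "mu",
          OF E_endo(1) De_endo(1) lin_De(1) lin_mu E_De(1) fst_E3(2) E_one(1) E_one(2) id_De(3)
          ext(3)[OF tens_in tens3_in] f g h])
  show "br (snd (De b) (tn w v)) h (\<lambda>s. br (snd E (tn s (u \<cdot> a))) g f) =
      br (snd E (tn b a)) (\<lambda>q. br (snd (De q) (tn w v)) h g) (\<lambda>p. f (u \<cdot> p))"
    by (rule E3_right[where e = "snd E" and d = "\<lambda>x. snd (De x)" and M = "snd E3" and m = "\<lambda>a b. b \<cdot> a",
          OF E_endo(2) De_endo(2) lin_De(2) lin_mu(2,1) E_De(2) snd_E3(1) E_one(3) E_one(4) id_De(4)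
          ext(4)[OF tens_in tens3_in] f g h])
qed

sublocale weak_bialgebra_data sc mu "\<lambda>a b. fst E (tn a b)" "\<lambda>a b. snd E (tn a b)"
  "\<lambda>x a b. fst (De x) (tn a b)" "\<lambda>x a b. snd (De x) (tn a b)"
  "T1 sc mu De" "T2 sc mu De" "T3 sc mu De" "T4 sc mu De"
proof
  show "fst E (tn a b) \<in> tensors" "snd E (tn a b) \<in> tensors" for a b
    by (simp_all add: E_endo)
  show "fst (De x) (tn a b) \<in> tensors" "snd (De x) (tn a b) \<in> tensors" for x a b
    by (simp_all add: De_endo)
  show "T1 sc mu De a b \<in> tensors" "T2 sc mu De a b \<in> tensors"
    "T3 sc mu De a b \<in> tensors" "T4 sc mu De a b \<in> tensors" for a b
    using T_mis[of a b] T_mis[of b a] by (simp_all only: mis_def)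
  fix f g :: "'a \<Rightarrow> 'k" assume f: "lfun f" and g: "lfun g"
  show "lfun (\<lambda>a. br (fst E (tn a b)) f g)" "lfun (\<lambda>b. br (fst E (tn a b)) f g)"
    "lfun (\<lambda>a. br (snd E (tn a b)) f g)" "lfun (\<lambda>b. br (snd E (tn a b)) f g)" for a b
    unfolding br_def by (rule lin_endo_tens E_endo)+
  show "lfun (\<lambda>x. br (fst (De x) (tn a b)) f g)" "lfun (\<lambda>x. br (snd (De x) (tn a b)) f g)" for a b
    unfolding br_def by (rule lin_De tens_in)+
  show "lfun (\<lambda>a. br (fst (De x) (tn a b)) f g)" "lfun (\<lambda>b. br (fst (De x) (tn a b)) f g)"
    "lfun (\<lambda>a. br (snd (De x) (tn a b)) f g)" "lfun (\<lambda>b. br (snd (De x) (tn a b)) f g)" for x a b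
    unfolding br_def by (rule lin_endo_tens De_endo)+
  show "br (fst E (tn a b)) (\<lambda>p. f (c \<cdot> p)) (\<lambda>q. g (d \<cdot> q)) =
      br (snd E (tn c d)) (\<lambda>p. f (p \<cdot> a)) (\<lambda>q. g (q \<cdot> b))" for a b c d
    by (rule is_mult_br[OF E_is_mult f g])
  show "br (fst (De x) (tn a b)) (\<lambda>p. f (c \<cdot> p)) (\<lambda>q. g (d \<cdot> q)) =
      br (snd (De x) (tn c d)) (\<lambda>p. f (p \<cdot> a)) (\<lambda>q. g (q \<cdot> b))" for x a b c d
    by (rule is_mult_br[OF De_is_mult f g])
  note bl = bilin_prod[OF f g]
  show "fst (De x) (tn a b) (\<lambda>p q. br (fst E (tn p q)) f g) = br (fst (De x) (tn a b)) f g" for x a b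
    unfolding br_def using endo_apply[OF E_endo(1) endo_in[OF De_endo(1) tens_in] bl, of x a b]
    by (simp only: E_De)
  show "snd (De x) (tn a b) (\<lambda>p q. br (snd E (tn p q)) f g) = br (snd (De x) (tn a b)) f g" for x a b
    unfolding br_def using endo_apply[OF E_endo(2) endo_in[OF De_endo(2) tens_in] bl, of x a b]
    by (simp only: E_De)
  show "fst E (tn a b) (\<lambda>p q. br (fst (De x) (tn p q)) f g) = br (fst (De x) (tn a b)) f g" for x a b
    unfolding br_def using endo_apply[OF De_endo(1) endo_in[OF E_endo(1) tens_in] bl, of x a b]
    by (simp only: De_E)
  show "snd E (tn a b) (\<lambda>p q. br (snd (De x) (tn p q)) f g) = br (snd (De x) (tn a b)) f g" for x a b
    unfolding br_def using endo_apply[OF De_endo(2) endo_in[OF E_endo(2) tens_in] bl, of x a b]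
    by (simp only: De_E)
  show "br (fst (De a) (tn u (b \<cdot> v))) f g = br (T1 sc mu De a b) (\<lambda>p. f (p \<cdot> u)) (\<lambda>q. g (q \<cdot> v))" for a b u v
    using br_mis(1)[OF T_mis(1) f g, of a b u v] by (simp add: mprod_def one_t_tens)
  show "br (snd (De b) (tn (u \<cdot> a) v)) f g = br (T2 sc mu De a b) (\<lambda>p. f (u \<cdot> p)) (\<lambda>q. g (v \<cdot> q))" for a b u v
    using br_mis(2)[OF T_mis(2) f g, of a b u v] by (simp add: mprod_def t_one_tens)
  show "br (snd (De a) (tn u (v \<cdot> b))) f g = br (T3 sc mu De a b) (\<lambda>p. f (u \<cdot> p)) (\<lambda>q. g (v \<cdot> q))" for a b u v
    using br_mis(2)[OF T_mis(3) f g, of b a u v] by (simp add: mprod_def one_t_tens)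
  show "br (fst (De b) (tn (a \<cdot> u) v)) f g = br (T4 sc mu De a b) (\<lambda>p. f (p \<cdot> u)) (\<lambda>q. g (q \<cdot> v))" for a b u v
    using br_mis(1)[OF T_mis(4) f g, of b a u v] by (simp add: mprod_def t_one_tens)
qed (rule E3_identities; assumption)+

sublocale weak_bialgebra sc mu "\<lambda>a b. fst E (tn a b)" "\<lambda>a b. snd E (tn a b)"
  "\<lambda>x a b. fst (De x) (tn a b)" "\<lambda>x a b. snd (De x) (tn a b)"
  "T1 sc mu De" "T2 sc mu De" "T3 sc mu De" "T4 sc mu De" eps
proof
  show eps: "lfun eps"
    using regular unfolding regular_wmba_def by (elim conjE)
  have counits: "\<forall>a b. slL eps (T1 sc mu De a b) = a \<cdot> b \<and> slR eps (T2 sc mu De a b) = a \<cdot> b"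
    using regular unfolding regular_wmba_def by (elim conjE)
  then show "slL eps (T1 sc mu De a b) = a \<cdot> b" "slR eps (T2 sc mu De a b) = a \<cdot> b" for a b
    by simp_all
  show "slL eps (T3 sc mu De a b) = b \<cdot> a" for a b
    by (rule counit_S3_if_S1[OF eps]) (simp add: counits)
  show "slR eps (T4 sc mu De a b) = b \<cdot> a" for a b
    by (rule counit_S4_if_S2[OF eps]) (simp add: counits)
qed

text \<open>The first half of axiom (vi), with Delta(c)(a (x) b) read as T4(a (x) c)(1 (x) b): the
  two actions of Pi^L(a) are compatible.\<close>

lemma sqL_multiplier: "c \<cdot> slL eps (fst E (tn a b)) = slL eps (T4 sc mu De a c) \<cdot> b"
proof (rule separate)
  fix g assume g: "lfun g"
  have *: "\<forall>a b c. slL eps (fst (one_t sc mu a) (fst E (tn b c))) = slL eps (fst (De a) (tn b c))"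
    using regular unfolding regular_wmba_def by (elim conjE)
  have one: "fst (one_t sc mu c) x = map_tens (\<lambda>p. p) (\<lambda>q. c \<cdot> q) x" for x
    by (simp add: one_t_def map_tens_def fun_eq_iff)
  have "g (c \<cdot> slL eps (fst E (tn a b))) = g (slL eps (fst (one_t sc mu c) (fst E (tn a b))))"
    unfolding one using g slL_apply[OF El_in lin_eps lin_mu(2)[OF g]]
    by (simp add: slL_apply br_map_tens)
  also have "\<dots> = br (T4 sc mu De a c) eps (\<lambda>q. g (q \<cdot> b))"
    using g by (simp add: * slL_apply S4_right)
  also have "\<dots> = g (slL eps (T4 sc mu De a c) \<cdot> b)"
    by (rule slL_apply[OF S4_in lin_eps lin_mu(1)[OF g], symmetric])
  finally show "g (c \<cdot> slL eps (fst E (tn a b))) = g (slL eps (T4 sc mu De a c) \<cdot> b)" .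
qed

text \<open>The second half of axiom (vi), with (a (x) b)Delta(c) read as (1 (x) b)T2(a (x)
  c).\<close>

lemma sqL_bar_multiplier: "slL eps (snd E (tn a b)) \<cdot> c = b \<cdot> slL eps (T2 sc mu De a c)"
proof (rule separate)
  fix g assume g: "lfun g"
  have *: "\<forall>a b c. slL eps (snd (one_t sc mu c) (snd E (tn a b))) = slL eps (snd (De c) (tn a b))"
    using regular unfolding regular_wmba_def by (elim conjE)
  have one: "snd (one_t sc mu c) x = map_tens (\<lambda>p. p) (\<lambda>q. q \<cdot> c) x" for x
    by (simp add: one_t_def map_tens_def fun_eq_iff)
  have "g (slL eps (snd E (tn a b)) \<cdot> c) = g (slL eps (snd (one_t sc mu c) (snd E (tn a b))))"
    unfolding one using g slL_apply[OF Er_in lin_eps lin_mu(1)[OF g]]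
    by (simp add: slL_apply br_map_tens)
  also have "\<dots> = br (T2 sc mu De a c) eps (\<lambda>q. g (b \<cdot> q))"
    using g by (simp add: * slL_apply S2_left)
  also have "\<dots> = g (b \<cdot> slL eps (T2 sc mu De a c))"
    by (rule slL_apply[OF S2_in lin_eps lin_mu(2)[OF g], symmetric])
  finally show "g (slL eps (snd E (tn a b)) \<cdot> c) = g (b \<cdot> slL eps (T2 sc mu De a c))" .
qed

lemmas sqR_bar_multiplier = slR_multiplier[OF sqL_bar_multiplier]
text \<open>In the opposite structure Pi^L takes the place of the barred Pi^L, so the other half of
  axiom (vi) is the hypothesis.\<close>

lemmas sqR_multiplier = weak_bialgebra.slR_multiplier[OF opposite, OF sqL_multiplier]

lemmas right_equivalences = sqR_equivalences[OF sqR_bar_multiplier sqR_multiplier]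

lemmas left_equivalences = weak_bialgebra.sqR_equivalences[OF coopposite, unfolded sl1_flip sl2_flip,
    OF sqL_multiplier sqL_bar_multiplier]

end

theorem theorem3p13:
  fixes sc :: "'k::field \<Rightarrow> 'a::ab_group_add \<Rightarrow> 'a"
    and mu :: "'a \<Rightarrow> 'a \<Rightarrow> 'a"
    and E :: "('k,'a) mlt"
    and De :: "'a \<Rightarrow> ('k,'a) mlt"
    and eps :: "'a \<Rightarrow> 'k"
  assumes "regular_wmba sc mu E De eps"
  defines "c1 \<equiv> module.span sc {sl2 sc w (T1 sc mu De a b) | a b w. lin sc w} = UNIV"
      and "c2 \<equiv> module.span sc {sl2 sc w (T3 sc mu De a b) | a b w. lin sc w} = UNIV"
      and "c3 \<equiv> module.span sc {sl2 sc eps (T1 sc mu De a b) | a b. True} = UNIV"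
      and "c4 \<equiv> module.span sc {sl2 sc eps (T3 sc mu De a b) | a b. True} = UNIV"
      and "c5 \<equiv> range (sqR sc mu E De eps) = range (sqR_bar sc mu E De eps)"
      and "d1 \<equiv> module.span sc {sl1 sc w (T2 sc mu De a b) | a b w. lin sc w} = UNIV"
      and "d2 \<equiv> module.span sc {sl1 sc w (T4 sc mu De a b) | a b w. lin sc w} = UNIV"
      and "d3 \<equiv> module.span sc {sl1 sc eps (T2 sc mu De a b) | a b. True} = UNIV"
      and "d4 \<equiv> module.span sc {sl1 sc eps (T4 sc mu De a b) | a b. True} = UNIV"
      and "d5 \<equiv> range (sqL sc mu E De eps) = range (sqL_bar sc mu E De eps)"
  shows "(c1 \<longleftrightarrow> c2) \<and> (c1 \<longleftrightarrow> c3) \<and> (c1 \<longleftrightarrow> c4) \<and> (c1 \<longleftrightarrow> c5) \<and>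
         (d1 \<longleftrightarrow> d2) \<and> (d1 \<longleftrightarrow> d3) \<and> (d1 \<longleftrightarrow> d4) \<and> (d1 \<longleftrightarrow> d5)"
proof -
  have "vector_space sc"
    using assms(1) unfolding regular_wmba_def by (elim conjE)
  then interpret regular_weak_multiplier_bialgebra sc mu E De eps
    using assms(1) by (simp add: regular_weak_multiplier_bialgebra_def tensor_square_def
        regular_weak_multiplier_bialgebra_axioms_def)
  have sq: "sqR sc mu E De eps = (\<lambda>w. (\<lambda>b. slR eps (T3 sc mu De b w), \<lambda>b. slR eps (snd E (tn b w))))"
    "sqR_bar sc mu E De eps = (\<lambda>z. (\<lambda>b. slR eps (fst E (tn b z)), \<lambda>b. slR eps (T1 sc mu De b z)))"
    "sqL sc mu E De eps = (\<lambda>z. (\<lambda>b. slL eps (fst E (tn z b)), \<lambda>b. slL eps (T4 sc mu De z b)))"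
    "sqL_bar sc mu E De eps = (\<lambda>w. (\<lambda>b. slL eps (T2 sc mu De w b), \<lambda>b. slL eps (snd E (tn w b))))"
    by (simp_all add: fun_eq_iff sqR_def sqR_bar_def sqL_def sqL_bar_def)
  have right: "(c1 \<longleftrightarrow> c2) \<and> (c1 \<longleftrightarrow> c3) \<and> (c1 \<longleftrightarrow> c4) \<and> (c1 \<longleftrightarrow> c5)"
    unfolding c1_def c2_def c3_def c4_def c5_def sq by (rule right_equivalences)
  \<comment> \<open>The coopposite maps take their arguments in exchanged order, which does not
    affect the set of slices.\<close>
  have swap: "{slL w (X a b) | a b w. lfun w} = {slL w (X b a) | a b w. lfun w}"
    "{slL eps (X a b) | a b. True} = {slL eps (X b a) | a b. True}" for X :: "'a \<Rightarrow> 'a \<Rightarrow> ('k,'a) ten"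
    by blast+
  have d1: "d1 \<longleftrightarrow> span {slL w (T2 sc mu De b a) | a b w. lfun w} = UNIV"
    unfolding d1_def by (subst swap(1)) (rule refl)
  have d2: "d2 \<longleftrightarrow> span {slL w (T4 sc mu De b a) | a b w. lfun w} = UNIV"
    unfolding d2_def by (subst swap(1)) (rule refl)
  have d3: "d3 \<longleftrightarrow> span {slL eps (T2 sc mu De b a) | a b. True} = UNIV"
    unfolding d3_def by (subst swap(2)) (rule refl)
  have d4: "d4 \<longleftrightarrow> span {slL eps (T4 sc mu De b a) | a b. True} = UNIV"
    unfolding d4_def by (subst swap(2)) (rule refl)
  have d5: "d5 \<longleftrightarrow> range (sqL_bar sc mu E De eps) = range (sqL sc mu E De eps)"
    unfolding d5_def by (rule eq_commute)
  \<comment> \<open>For the coopposite structure, conditions (1), (2), (3), (4) are (2'), (1'),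
    (4'), (3'), and (5) is (5') with its sides exchanged; hence \<open>d2\<close> comes
    first.\<close>
  have "(d2 \<longleftrightarrow> d1) \<and> (d2 \<longleftrightarrow> d4) \<and> (d2 \<longleftrightarrow> d3) \<and> (d2 \<longleftrightarrow> d5)"
    unfolding d1 d2 d3 d4 d5 sq
    by (rule left_equivalences)
  with right show ?thesis by blast
qed

end
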